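(* Let $K$ be a field, $L=K\{\{t\}\}$ the field of formal Puiseux series over $K$, $N\geq 1$ an integer and $R_N=K[[t^{1/N}]]$. Let $J\unlhd L[\underline{x}]$ and $I\unlhd R_N[\underline{x}]$ be ideals with $J=\langle I\rangle_{L[\underline{x}]}$, let $w\in\mathbb{R}_{<0}\times\mathbb{R}^n$, and let $G$ be a standard basis of $I$ with respect to $>_w$. Then $$\text{t-in}_w(J)=\text{t-in}_w(I)=\big\langle \text{t-in}_w(g)\mid g\in G\big\rangle$$ as ideals of $K[\underline{x}]$.
   Context: $\underline{x}=(x_1,\ldots,x_n)$. $R_N=K[[t^{1/N}]]$ is the ring of formal power series in $t^{1/N}$, $L_N=\mathrm{Quot}(R_N)$, with $R_N\subseteq R_M$ and $L_N\subseteq L_M$ whenever $N\mid M$, and $L=K\{\{t\}\}=\bigcup_{N\ge 1}L_N$. Fix a global monomial ordering $>$ on $\mathrm{Mon}(\underline{x})$ (a total ordering compatible with multiplication with $x_i>1$ for all $i$). For $w=(w_0,\ldots,w_n)\in\mathbb{R}_{<0}\times\mathbb{R}^n$ the ordering $>_w$ on $\mathrm{Mon}(t^{1/N},\underline{x})=\{t^{\alpha/N}\underline{x}^\beta\mid\alpha\in\mathbb{N},\beta\in\mathbb{N}^n\}$ is defined by: $t^{\alpha/N}\underline{x}^\beta>_w t^{\alpha'/N}\underline{x}^{\beta'}$ iff $w\cdot(\alpha/N,\beta)>w\cdot(\alpha'/N,\beta')$, or these are equal and $\underline{x}^\beta>\underline{x}^{\beta'}$. (Here $w\cdot$ is the standard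 scalar product.) For $0\neq f\in R_N[\underline{x}]$, $\mathrm{lm}_{>_w}(f)$ is the largest monomial occurring in $f$ with non-zero coefficient (it exists since $w_0<0$); $\mathrm{lm}_{>_w}(0)=0$. For a subset $G\subseteq R_N[\underline{x}]$ let $L_{>_w}(G)=\langle\mathrm{lm}_{>_w}(g)\mid g\in G\rangle\unlhd K[t^{1/N},\underline{x}]$. A standard basis of an ideal $I\unlhd R_N[\underline{x}]$ is a finite subset $G\subset I$ with $L_{>_w}(G)=L_{>_w}(I)$ (it need not generate $I$). For $0\ne f\in R_N[\underline{x}]$, let $\hat q$ be the maximal value of $w\cdot(\alpha/N,\beta)$ among the monomials $t^{\alpha/N}\underline{x}^\beta$ occurring in $f$; $\mathrm{in}_w(f)\in K[t^{1/N},\underline{x}]$ is the (finite) sum of the terms of $f$ with $w\cdot(\alpha/N,\beta)=\hat q$, and $\text{t-in}_w(f)=\mathrm{in}_w(f)_{|t=1}\in K[\underline{x}]$ (substituting $1$ for $t^{1/N}$); both are $0$ for $f=0$. For $f=t^{-\alpha/N}g\in L[\underline{x}]$ with $g\in R_N[\underline{x}]$ put $\text{t-in}_w(f)=\text{t-in}_w(g)$ (independent of the representation). For an ideal $I$ of $L[\underline{x}]$ or of $R_N[\underline{x}]$, $\text{t-in}_w(I)=\langle\text{t-in}_w(f)\mid f\in I\rangle\unlhd K[\underline{x}]$. *)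

theory Defs
  imports
    "HOL-Analysis.Analysis"
    "HOL-Computational_Algebra.Formal_Laurent_Series"
    "HOL-Library.Poly_Mapping"
begin

section \<open>Formal Puiseux series\<close>

definition is_puiseux :: "(rat \<Rightarrow> 'a::zero) \<Rightarrow> bool" where
  "is_puiseux f \<longleftrightarrow>
     (\<exists>N::nat. N > 0 \<and> (\<exists>m::int. \<forall>q. f q \<noteq> 0 \<longrightarrow> (\<exists>k\<ge>m. q = of_int k / of_nat N)))"

text \<open>
  A series is given by its coefficient function: the coefficient at \<open>q\<close> is that of \<open>t\<^sup>q\<close>.
\<close>

typedef (overloaded) 'a puiseux = "{f :: rat \<Rightarrow> 'a::zero. is_puiseux f}"
  morphisms puiseux_nth Abs_puiseux
  by (rule exI[of _ "\<lambda>_. 0"]) (auto simp: is_puiseux_def)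

setup_lifting type_definition_puiseux

lemma puiseux_eqI: "(\<And>q. puiseux_nth f q = puiseux_nth g q) \<Longrightarrow> f = g"
  by (metis puiseux_nth_inject ext)

text \<open>The coefficient function of \<open>F(t\<^sup>1\<^sup>/\<^sup>N)\<close> for a Laurent series \<open>F\<close>; zero for \<open>N = 0\<close>.\<close>

definition stretch :: "nat \<Rightarrow> 'a::zero fls \<Rightarrow> rat \<Rightarrow> 'a" where
  "stretch N F q =
     (if N > 0 \<and> q * of_nat N \<in> \<int> then fls_nth F \<lfloor>q * of_nat N\<rfloor> else 0)"

lemma stretch_nth [simp]: "N > 0 \<Longrightarrow> stretch N F (of_int k / of_nat N) = fls_nth F k"
  by (simp add: stretch_def)

lemma stretch_eq_0: "(\<And>k. q \<noteq> of_int k / of_nat N) \<Longrightarrow> stretch N F q = 0"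
  by (metis stretch_def Ints_cases nonzero_mult_div_cancel_right of_nat_0_eq_iff not_gr_zero)

lemma stretch_nonzeroE:
  assumes "stretch N F q \<noteq> 0"
  obtains k where "N > 0" "q = of_int k / of_nat N" "fls_nth F k \<noteq> 0"
proof -
  have N: "N > 0" using assms by (auto simp: stretch_def split: if_splits)
  obtain k where k: "q = of_int k / of_nat N" using assms stretch_eq_0 by metis
  show thesis using that[OF N k] assms N unfolding k by simp
qed

lemma stretch_eqI:
  assumes "N > 0" "\<And>k. f (of_int k / of_nat N) = fls_nth F k"
    and "\<And>q. (\<And>k. q \<noteq> of_int k / of_nat N) \<Longrightarrow> f q = 0"
  shows "f = stretch N F"
proof
  fix q show "f q = stretch N F q"
  proof (cases "\<exists>k. q = of_int k / of_nat N")
    case True then show ?thesis using assms by auto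
  next
    case False then show ?thesis using assms(3)[of q] stretch_eq_0[of q N F] by metis
  qed
qed

lemma is_puiseux_stretch: "is_puiseux (stretch N F)"
proof (cases "N > 0")
  case True
  then show ?thesis unfolding is_puiseux_def
    by (intro exI[of _ N] conjI exI[of _ "fls_subdegree F"])
       (auto elim!: stretch_nonzeroE intro: fls_subdegree_leI)
qed (auto simp: is_puiseux_def stretch_def)

lemma stretch_refine:
  assumes f: "is_puiseux f"
  obtains N where "N > 0" "\<And>M. M > 0 \<Longrightarrow> \<exists>F. f = stretch (N * M) F"
proof -
  from f obtain N m where N: "N > 0"
    and m: "\<And>q. f q \<noteq> 0 \<Longrightarrow> \<exists>k\<ge>m::int. q = of_int k / of_nat N"
    unfolding is_puiseux_def by blast
  have "\<exists>F. f = stretch (N * M) F" if M: "M > 0" for M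
  proof -
    have *: "\<exists>k\<ge>m * int M. q = of_int k / of_nat (N * M)" if q: "f q \<noteq> 0" for q
    proof -
      obtain k where k: "k \<ge> m" "q = of_int k / of_nat N" using m q by blast
      have "m * int M \<le> k * int M" using k by (simp add: mult_right_mono)
      moreover have "q = of_int (k * int M) / of_nat (N * M)" using k M N by simp
      ultimately show ?thesis by blast
    qed
    define F where "F = Abs_fls (\<lambda>k. f (of_int k / of_nat (N * M)))"
    have F: "fls_nth F k = f (of_int k / of_nat (N * M))" for k
      unfolding F_def
    proof (rule nth_Abs_fls_ex_lower_bound, intro exI[of _ "m * int M"] allI impI)
      fix k assume k: "k < m * int M"
      show "f (of_int k / of_nat (N * M)) = 0"
      proof (rule ccontr)
        assume "f (of_int k / of_nat (N * M)) \<noteq> 0"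
        then obtain l where l: "l \<ge> m * int M"
          "of_int k / of_nat (N * M) = (of_int l / of_nat (N * M) :: rat)"
          using * by blast
        have "k = l" using l(2) M N by simp
        then show False using l k by simp
      qed
    qed
    have "f = stretch (N * M) F"
      by (rule stretch_eqI) (use M N F * in \<open>auto\<close>)
    then show ?thesis ..
  qed
  then show thesis using that N by blast
qed

lemma stretch_common:
  assumes "is_puiseux f" "is_puiseux g"
  obtains N F G where "N > 0" "f = stretch N F" "g = stretch N G"
proof -
  obtain N M where N: "N > 0" "\<And>M. M > 0 \<Longrightarrow> \<exists>F. f = stretch (N * M) F"
    and M: "M > 0" "\<And>N. N > 0 \<Longrightarrow> \<exists>F. g = stretch (M * N) F"
    using assms by (metis stretch_refine)
  obtain F G where "f = stretch (N * M) F" "g = stretch (M * N) G" using N M by metis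
  then show thesis using that[of "N * M" F G] N M by (simp add: mult.commute)
qed

lemma stretch_common3:
  assumes "is_puiseux f" "is_puiseux g" "is_puiseux h"
  obtains N F G H where "N > 0" "f = stretch N F" "g = stretch N G" "h = stretch N H"
proof -
  obtain N M P where N: "N > 0" "\<And>M. M > 0 \<Longrightarrow> \<exists>F. f = stretch (N * M) F"
    and M: "M > 0" "\<And>N. N > 0 \<Longrightarrow> \<exists>F. g = stretch (M * N) F"
    and P: "P > 0" "\<And>N. N > 0 \<Longrightarrow> \<exists>F. h = stretch (P * N) F"
    using assms by (metis stretch_refine)
  obtain F G H where "f = stretch (N * (M * P)) F" "g = stretch (M * (N * P)) G"
    "h = stretch (P * (N * M)) H" using N M P by (metis mult_pos_pos)
  then show thesis using that[of "N * M * P" F G H] N M P by (simp add: mult_ac)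
qed

text \<open>Convolution; the index set is finite for coefficient functions of Puiseux series.\<close>

definition conv :: "(rat \<Rightarrow> 'a::semiring_0) \<Rightarrow> (rat \<Rightarrow> 'a) \<Rightarrow> rat \<Rightarrow> 'a" where
  "conv f g q = (\<Sum>r | f r \<noteq> 0 \<and> g (q - r) \<noteq> 0. f r * g (q - r))"

lemma stretch_conv: "conv (stretch N F) (stretch N G) = stretch N (F * G)"
proof (cases "N > 0")
  case N: True
  show ?thesis
  proof (rule stretch_eqI[OF N])
    fix n :: int
    let ?A = "{fls_subdegree F..n - fls_subdegree G}"
    let ?B = "{i. fls_nth F i \<noteq> 0 \<and> fls_nth G (n - i) \<noteq> 0}"
    let ?d = "\<lambda>i::int. of_int i / of_nat N :: rat"
    have sub: "?B \<subseteq> ?A" using fls_subdegree_leI[of F] fls_subdegree_leI[of G] by force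
    have diff: "?d n - ?d i = ?d (n - i)" for i by (simp add: diff_divide_distrib)
    have im: "{r. stretch N F r \<noteq> 0 \<and> stretch N G (?d n - r) \<noteq> 0} = ?d ` ?B"
    proof (intro set_eqI iffI)
      fix r assume "r \<in> {r. stretch N F r \<noteq> 0 \<and> stretch N G (?d n - r) \<noteq> 0}"
      then have r: "stretch N F r \<noteq> 0" "stretch N G (?d n - r) \<noteq> 0" by auto
      from r(1) obtain i where i: "r = ?d i" "fls_nth F i \<noteq> 0" by (rule stretch_nonzeroE)
      with r(2) show "r \<in> ?d ` ?B" using N by (auto simp only: diff stretch_nth)
    qed (use N in \<open>auto simp only: diff stretch_nth\<close>)
    have inj: "inj_on ?d ?B" using N by (auto intro: inj_onI)
    have "conv (stretch N F) (stretch N G) (?d n) = (\<Sum>i\<in>?B. fls_nth F i * fls_nth G (n - i))"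
      unfolding conv_def im sum.reindex[OF inj] o_def by (simp only: diff stretch_nth[OF N])
    also have "\<dots> = (\<Sum>i\<in>?A. fls_nth F i * fls_nth G (n - i))"
      by (rule sum.mono_neutral_left) (use sub in auto)
    also have "\<dots> = fls_nth (F * G) n" by (simp add: fls_times_nth(2))
    finally show "conv (stretch N F) (stretch N G) (?d n) = fls_nth (F * G) n" .
  next
    fix q :: rat assume q: "\<And>k. q \<noteq> of_int k / of_nat N"
    have "{r. stretch N F r \<noteq> 0 \<and> stretch N G (q - r) \<noteq> 0} = {}"
    proof (intro equals0I)
      fix r assume "r \<in> {r. stretch N F r \<noteq> 0 \<and> stretch N G (q - r) \<noteq> 0}"
      then obtain k l where "r = of_int k / of_nat N" "q - r = of_int l / of_nat N"
        by (auto elim!: stretch_nonzeroE)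
      then have "q = of_int (k + l) / of_nat N" by (simp add: add_divide_distrib)
      then show False using q by blast
    qed
    then show "conv (stretch N F) (stretch N G) q = 0"
      unfolding conv_def by (simp only: sum.empty)
  qed
qed (auto simp: stretch_def conv_def fun_eq_iff)

lemma stretch_0: "stretch N 0 = (\<lambda>_. 0)"
  and stretch_plus: "stretch N (F + G) = (\<lambda>q. stretch N F q + stretch N G q)"
  for F G :: "'a::comm_ring_1 fls"
  by (auto simp: stretch_def fun_eq_iff)

lemma stretch_uminus: "stretch N (- F) = (\<lambda>q. - stretch N F q)"
  and stretch_minus: "stretch N (F - G) = (\<lambda>q. stretch N F q - stretch N G q)"
  for F G :: "'a::comm_ring_1 fls"
  by (auto simp: stretch_def fun_eq_iff)

lemma stretch_1: "N > 0 \<Longrightarrow> stretch N 1 = (\<lambda>q. if q = 0 then 1 else 0)"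
  for N :: nat
  by (rule stretch_eqI[symmetric]) (auto, metis div_0 of_int_0)

lemma puiseux_is_puiseux: "is_puiseux (puiseux_nth f)"
  using puiseux_nth by blast

instantiation puiseux :: (comm_ring_1) comm_ring_1
begin

lift_definition zero_puiseux :: "'a puiseux" is "\<lambda>_. 0"
  by (simp add: is_puiseux_def, rule exI[of _ 1], simp)

lift_definition one_puiseux :: "'a puiseux" is "\<lambda>q. if q = 0 then 1 else 0"
  using is_puiseux_stretch[of 1 "1 :: 'a fls"] by (simp add: stretch_1)

lift_definition plus_puiseux :: "'a puiseux \<Rightarrow> 'a puiseux \<Rightarrow> 'a puiseux"
  is "\<lambda>f g q. f q + g q"
  by (erule (1) stretch_common) (simp flip: stretch_plus add: is_puiseux_stretch)

lift_definition uminus_puiseux :: "'a puiseux \<Rightarrow> 'a puiseux" is "\<lambda>f q. - f q"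
  by (simp add: is_puiseux_def)

lift_definition minus_puiseux :: "'a puiseux \<Rightarrow> 'a puiseux \<Rightarrow> 'a puiseux"
  is "\<lambda>f g q. f q - g q"
  by (erule (1) stretch_common) (simp flip: stretch_minus add: is_puiseux_stretch)

lift_definition times_puiseux :: "'a puiseux \<Rightarrow> 'a puiseux \<Rightarrow> 'a puiseux" is conv
  by (erule (1) stretch_common) (simp add: stretch_conv is_puiseux_stretch)

instance
proof
  fix a b c :: "'a puiseux"
  show "a + b + c = a + (b + c)" "a + b = b + a" "0 + a = a" "- a + a = 0" "a - b = a + - b"
    by (transfer; simp add: fun_eq_iff add_ac)+
  show "(0::'a puiseux) \<noteq> 1" by transfer (simp add: fun_eq_iff)
  show "a * b * c = a * (b * c)"
  proof transfer
    fix a b c :: "rat \<Rightarrow> 'a" assume *: "is_puiseux a" "is_puiseux b" "is_puiseux c"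
    from * show "conv (conv a b) c = conv a (conv b c)"
      by (rule stretch_common3) (simp add: stretch_conv mult.assoc)
  qed
  show "(a + b) * c = a * c + b * c"
  proof transfer
    fix a b c :: "rat \<Rightarrow> 'a" assume *: "is_puiseux a" "is_puiseux b" "is_puiseux c"
    from * show "conv (\<lambda>q. a q + b q) c = (\<lambda>q. conv a c q + conv b c q)"
      by (rule stretch_common3) (simp flip: stretch_plus add: stretch_conv distrib_right)
  qed
  show "a * b = b * a"
  proof transfer
    fix a b :: "rat \<Rightarrow> 'a" assume *: "is_puiseux a" "is_puiseux b"
    from * show "conv a b = conv b a"
      by (rule stretch_common) (simp add: stretch_conv mult.commute)
  qed
  show "1 * a = a"
  proof transfer
    fix a :: "rat \<Rightarrow> 'a" assume *: "is_puiseux a"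
    from * * show "conv (\<lambda>q. if q = 0 then 1 else 0) a = a"
      by (rule stretch_common) (simp flip: stretch_1 add: stretch_conv)
  qed
qed

end

lemma puiseux_inverse_exists:
  fixes f :: "'a::field puiseux"
  assumes "f \<noteq> 0"
  shows "\<exists>g. g * f = 1"
  using assms
proof transfer
  fix f :: "rat \<Rightarrow> 'a" assume f: "is_puiseux f" "f \<noteq> (\<lambda>_. 0)"
  obtain N F where N: "N > 0" "f = stretch N F" using stretch_common f by blast
  have "F \<noteq> 0" using N f stretch_0 by metis
  then have "conv (stretch N (inverse F)) f = stretch N 1"
    unfolding N stretch_conv by simp
  then show "\<exists>g\<in>Collect is_puiseux. conv g f = (\<lambda>q. if q = 0 then 1 else 0)"
    using N stretch_1 is_puiseux_stretch by (metis mem_Collect_eq)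
qed

instantiation puiseux :: (field) field
begin

definition inverse_puiseux :: "'a puiseux \<Rightarrow> 'a puiseux" where
  "inverse_puiseux f = (if f = 0 then 0 else (SOME g. g * f = 1))"

definition divide_puiseux :: "'a puiseux \<Rightarrow> 'a puiseux \<Rightarrow> 'a puiseux" where
  "divide_puiseux f g = f * inverse g"

instance
proof
  fix a b :: "'a puiseux"
  show "a \<noteq> 0 \<Longrightarrow> inverse a * a = 1"
    unfolding inverse_puiseux_def by (simp add: someI_ex[OF puiseux_inverse_exists])
qed (simp_all add: inverse_puiseux_def divide_puiseux_def)

end

text \<open>\<open>puiseux_of_fls N\<close> embeds \<open>L\<^sub>N\<close>, as Laurent series in \<open>t\<^sup>1\<^sup>/\<^sup>N\<close>, into \<open>L\<close>.\<close>

lift_definition puiseux_of_fls :: "nat \<Rightarrow> 'a::zero fls \<Rightarrow> 'a puiseux" is stretch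
  by (rule is_puiseux_stretch)

lemma puiseux_of_fls_surj: "\<exists>N>0. \<exists>F. f = puiseux_of_fls N F"
proof transfer
  fix f :: "rat \<Rightarrow> 'a" assume "is_puiseux f"
  from this this show "\<exists>N>0. \<exists>F. f = stretch N F" by (rule stretch_common) blast
qed

definition puiseux_of_fps :: "nat \<Rightarrow> 'a::zero fps \<Rightarrow> 'a puiseux" where
  "puiseux_of_fps N F = puiseux_of_fls N (fps_to_fls F)"

lemma puiseux_of_fls_0: "puiseux_of_fls N 0 = (0::'a puiseux)"
  and puiseux_of_fls_add:
    "puiseux_of_fls N (F + G) = puiseux_of_fls N F + (puiseux_of_fls N G :: 'a puiseux)"
  and puiseux_of_fls_mult:
    "puiseux_of_fls N (F * G) = puiseux_of_fls N F * (puiseux_of_fls N G :: 'a puiseux)"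
  and puiseux_of_fls_1: "N > 0 \<Longrightarrow> puiseux_of_fls N 1 = (1::'a puiseux)"
  for F G :: "'a::comm_ring_1 fls"
  by (simp_all add: puiseux_nth_inject[symmetric] puiseux_of_fls.rep_eq zero_puiseux.rep_eq
      one_puiseux.rep_eq plus_puiseux.rep_eq times_puiseux.rep_eq
      stretch_0 stretch_1 stretch_plus stretch_conv)

lemma inj_puiseux_of_fls: "N > 0 \<Longrightarrow> inj (puiseux_of_fls N)"
proof (rule injI)
  fix F G :: "'a fls" assume "N > 0" "puiseux_of_fls N F = puiseux_of_fls N G"
  then have "fls_nth F k = fls_nth G k" for k
    by (metis puiseux_of_fls.rep_eq stretch_nth)
  then show "F = G" by (rule fls_eqI)
qed

lemma puiseux_nth_of_fps: "N > 0 \<Longrightarrow> puiseux_nth (puiseux_of_fps N F) (of_nat k / of_nat N) = fps_nth F k"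
  unfolding puiseux_of_fps_def
  using stretch_nth[of N "fps_to_fls F" "int k"] by (simp add: puiseux_of_fls.rep_eq)

lemma puiseux_nth_of_fps_nonzeroE:
  assumes "puiseux_nth (puiseux_of_fps N F) q \<noteq> 0"
  obtains k where "q = of_nat k / of_nat N"
proof -
  from assms have "stretch N (fps_to_fls F) q \<noteq> 0"
    by (simp add: puiseux_of_fps_def puiseux_of_fls.rep_eq)
  then obtain k where k: "q = of_int k / of_nat N" "fls_nth (fps_to_fls F) k \<noteq> 0"
    by (rule stretch_nonzeroE)
  have "k \<ge> 0" using k(2) by (auto split: if_splits)
  then show thesis using that[of "nat k"] k by simp
qed

lift_definition puiseux_t_pow :: "rat \<Rightarrow> 'a::comm_ring_1 puiseux"
  is "\<lambda>r q. if q = r then 1 else 0"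
proof -
  fix r :: rat
  obtain a b where r: "r = of_int a / of_int b" "b > 0"
    by (metis Fract_of_int_quotient Rat_cases)
  show "is_puiseux (\<lambda>q. if q = r then 1 else (0::'a))"
    unfolding is_puiseux_def
    by (intro exI[of _ "nat b"] conjI exI[of _ a]) (use r in auto)
qed

lemma puiseux_nth_t_pow_mult: "puiseux_nth (puiseux_t_pow r * f) q = puiseux_nth f (q - r)"
proof transfer
  fix r q :: rat and f :: "rat \<Rightarrow> 'a"
  have "{s. (if s = r then 1 else 0) \<noteq> (0::'a) \<and> f (q - s) \<noteq> 0} = (if f (q - r) = 0 then {} else {r})"
    by auto
  then show "conv (\<lambda>q. if q = r then 1 else 0) f q = f (q - r)"
    unfolding conv_def by simp
qed


section \<open>Polynomial rings and ideals\<close>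

text \<open>
  The monomial \<open>x\<^sup>\<beta>\<close> is represented by \<open>\<beta> :: 'n \<Rightarrow>\<^sub>0 nat\<close> and \<open>t\<^sup>\<alpha>\<^sup>/\<^sup>N x\<^sup>\<beta>\<close> by the pair
  \<open>(\<alpha>, \<beta>)\<close>; multiplication of monomials is addition.  A coefficient \<open>F :: 'a fps\<close> stands for
  \<open>F(t\<^sup>1\<^sup>/\<^sup>N)\<close>; as \<open>N\<close> is not part of the type, it is an argument of every function that
  depends on the exponents of \<open>t\<close>.
\<close>

type_synonym 'n mon = "'n \<Rightarrow>\<^sub>0 nat"
type_synonym 'n tmon = "nat \<times> 'n mon"
type_synonym ('n, 'a) Kx = "'n mon \<Rightarrow>\<^sub>0 'a"  \<comment> \<open>\<open>K[x]\<close>\<close>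
type_synonym ('n, 'a) Ktx = "'n tmon \<Rightarrow>\<^sub>0 'a"  \<comment> \<open>\<open>K[t\<^sup>1\<^sup>/\<^sup>N, x]\<close>\<close>
type_synonym ('n, 'a) Rx = "'n mon \<Rightarrow>\<^sub>0 'a fps"  \<comment> \<open>\<open>R\<^sub>N[x]\<close>\<close>
type_synonym ('n, 'a) Lx = "'n mon \<Rightarrow>\<^sub>0 'a puiseux"  \<comment> \<open>\<open>L[x]\<close>\<close>

text \<open>The ideals of a commutative ring are the submodules of the ring over itself.\<close>

global_interpretation ideal: module "(*) :: 'a::comm_ring_1 \<Rightarrow> 'a \<Rightarrow> 'a"
  defines is_ideal = ideal.subspace and ideal_gen = ideal.span
  by standard (simp_all add: algebra_simps)

definition Lx_of_Rx :: "nat \<Rightarrow> ('n, 'a::field) Rx \<Rightarrow> ('n, 'a) Lx" where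
  "Lx_of_Rx N = Poly_Mapping.map (puiseux_of_fps N)"

definition occ :: "('n, 'a::zero) Rx \<Rightarrow> 'n tmon set" where
  "occ f = {(\<alpha>, \<beta>). fps_nth (Poly_Mapping.lookup f \<beta>) \<alpha> \<noteq> 0}"


section \<open>Monomial orderings and standard bases\<close>

definition global_monomial_ordering :: "('n mon \<Rightarrow> 'n mon \<Rightarrow> bool) \<Rightarrow> bool" where
  "global_monomial_ordering gt \<longleftrightarrow>
     irreflp gt \<and> transp gt \<and> totalp gt \<and>
     (\<forall>a b c. gt a b \<longrightarrow> gt (a + c) (b + c)) \<and>
     (\<forall>i. gt (Poly_Mapping.single i 1) 0)"

definition weight :: "real \<times> (real ^ 'n) \<Rightarrow> nat \<Rightarrow> 'n::finite tmon \<Rightarrow> real" where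
  "weight w N m = w \<bullet> (real (fst m) / real N, \<chi> i. real (Poly_Mapping.lookup (snd m) i))"

definition gt_w ::
  "('n::finite mon \<Rightarrow> 'n mon \<Rightarrow> bool) \<Rightarrow> real \<times> (real ^ 'n) \<Rightarrow> nat \<Rightarrow> 'n tmon \<Rightarrow> 'n tmon \<Rightarrow> bool"
where
  "gt_w gt w N m m' \<longleftrightarrow>
     weight w N m > weight w N m' \<or> weight w N m = weight w N m' \<and> gt (snd m) (snd m')"

definition lm ::
  "('n::finite mon \<Rightarrow> 'n mon \<Rightarrow> bool) \<Rightarrow> real \<times> (real ^ 'n) \<Rightarrow> nat \<Rightarrow>
    ('n, 'a::field) Rx \<Rightarrow> ('n, 'a) Ktx"
where
  "lm gt w N f =
     (if f = 0 then 0
      else Poly_Mapping.single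
        (THE m. m \<in> occ f \<and> (\<forall>m'\<in>occ f. m' \<noteq> m \<longrightarrow> gt_w gt w N m m')) 1)"

definition leading_ideal ::
  "('n::finite mon \<Rightarrow> 'n mon \<Rightarrow> bool) \<Rightarrow> real \<times> (real ^ 'n) \<Rightarrow> nat \<Rightarrow>
    ('n, 'a::field) Rx set \<Rightarrow> ('n, 'a) Ktx set"
where
  "leading_ideal gt w N G = ideal_gen (lm gt w N ` G)"

definition standard_basis ::
  "('n::finite mon \<Rightarrow> 'n mon \<Rightarrow> bool) \<Rightarrow> real \<times> (real ^ 'n) \<Rightarrow> nat \<Rightarrow>
    ('n, 'a::field) Rx set \<Rightarrow> ('n, 'a) Rx set \<Rightarrow> bool"
where
  "standard_basis gt w N I G \<longleftrightarrow>
     finite G \<and> G \<subseteq> I \<and> leading_ideal gt w N G = leading_ideal gt w N I"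


section \<open>Initial forms\<close>

definition max_weight ::
  "real \<times> (real ^ 'n) \<Rightarrow> nat \<Rightarrow> ('n::finite, 'a::zero) Rx \<Rightarrow> real" where
  "max_weight w N f = (GREATEST q. q \<in> weight w N ` occ f)"

definition initial_form ::
  "real \<times> (real ^ 'n) \<Rightarrow> nat \<Rightarrow> ('n::finite, 'a::field) Rx \<Rightarrow> ('n, 'a) Ktx" where
  "initial_form w N f =
     (\<Sum>m | m \<in> occ f \<and> weight w N m = max_weight w N f.
        Poly_Mapping.single m (fps_nth (Poly_Mapping.lookup f (snd m)) (fst m)))"

definition subst_t_1 :: "('n, 'a::field) Ktx \<Rightarrow> ('n, 'a) Kx" where
  "subst_t_1 h = (\<Sum>m\<in>Poly_Mapping.keys h. Poly_Mapping.single (snd m) (Poly_Mapping.lookup h m))"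

definition t_initial ::
  "real \<times> (real ^ 'n) \<Rightarrow> nat \<Rightarrow> ('n::finite, 'a::field) Rx \<Rightarrow> ('n, 'a) Kx" where
  "t_initial w N f = subst_t_1 (initial_form w N f)"

text \<open>
  For \<open>f = t\<^sup>-\<^sup>\<alpha>\<^sup>/\<^sup>N g\<close> with \<open>g \<in> R\<^sub>N[x]\<close>, for any \<open>N\<close>.  Existence of such a representation and
  independence of its choice are \<open>Lx_representation\<close> and \<open>t_initial_unique\<close> below.
\<close>

definition t_initial_L ::
  "real \<times> (real ^ 'n) \<Rightarrow> ('n::finite, 'a::field) Lx \<Rightarrow> ('n, 'a) Kx" where
  "t_initial_L w f =
     (THE h. \<exists>N \<alpha> g. N > 0 \<and>
        f = Poly_Mapping.single 0 (puiseux_t_pow (- (of_nat \<alpha> / of_nat N))) * Lx_of_Rx N g \<and>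
        h = t_initial w N g)"

definition t_initial_ideal ::
  "real \<times> (real ^ 'n) \<Rightarrow> nat \<Rightarrow> ('n::finite, 'a::field) Rx set \<Rightarrow> ('n, 'a) Kx set" where
  "t_initial_ideal w N I = ideal_gen (t_initial w N ` I)"

definition t_initial_ideal_L ::
  "real \<times> (real ^ 'n) \<Rightarrow> ('n::finite, 'a::field) Lx set \<Rightarrow> ('n, 'a) Kx set" where
  "t_initial_ideal_L w J = ideal_gen (t_initial_L w ` J)"


section \<open>Well-definedness\<close>

lemma weight_eq:
  "weight w N (\<alpha>, \<beta>) = fst w * real \<alpha> / real N + snd w \<bullet> (\<chi> i. real (Poly_Mapping.lookup \<beta> i))"
  by (simp add: weight_def inner_prod_def)

lemma finite_occ_weight_ge:
  fixes f :: "('n::finite, 'a::zero) Rx"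
  assumes "fst w < 0" "N > 0"
  shows "finite {m \<in> occ f. weight w N m \<ge> q}"
proof -
  define b where "b \<beta> = nat \<lfloor>(snd w \<bullet> (\<chi> i. real (Poly_Mapping.lookup \<beta> i)) - q) * real N / - fst w\<rfloor>" for \<beta> :: "'n mon"
  have "{m \<in> occ f. weight w N m \<ge> q} \<subseteq> (\<Union>\<beta>\<in>Poly_Mapping.keys f. (\<lambda>\<alpha>. (\<alpha>, \<beta>)) ` {..b \<beta>})"
  proof (clarify)
    fix \<alpha> \<beta> assume m: "(\<alpha>, \<beta>) \<in> occ f" "weight w N (\<alpha>, \<beta>) \<ge> q"
    have "\<beta> \<in> Poly_Mapping.keys f" using m(1) by (auto simp: occ_def in_keys_iff)
    moreover have "real \<alpha> \<le> (snd w \<bullet> (\<chi> i. real (Poly_Mapping.lookup \<beta> i)) - q) * real N / - fst w"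
      using m(2) assms by (simp add: weight_eq field_simps)
    then have "\<alpha> \<le> b \<beta>" unfolding b_def by (simp add: le_nat_floor)
    ultimately show "(\<alpha>, \<beta>) \<in> (\<Union>\<beta>\<in>Poly_Mapping.keys f. (\<lambda>\<alpha>. (\<alpha>, \<beta>)) ` {..b \<beta>})" by auto
  qed
  then show ?thesis by (rule finite_subset) auto
qed

lemma occ_eq_empty_iff [simp]: "occ f = {} \<longleftrightarrow> f = 0"
proof
  assume "occ f = {}"
  then have "Poly_Mapping.lookup f \<beta> = 0" for \<beta> by (intro fps_ext) (auto simp: occ_def)
  then show "f = 0" by (intro poly_mapping_eqI) simp
qed (auto simp: occ_def)

lemma max_weight:
  assumes "fst w < 0" "N > 0" "f \<noteq> 0"
  shows "\<exists>m\<in>occ f. weight w N m = max_weight w N f"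
    and "m \<in> occ f \<Longrightarrow> weight w N m \<le> max_weight w N f"
proof -
  from assms(3) obtain m0 where m0: "m0 \<in> occ f" by (metis occ_eq_empty_iff equals0I)
  define A where "A = {m \<in> occ f. weight w N m \<ge> weight w N m0}"
  have A: "finite A" "m0 \<in> A"
    unfolding A_def using finite_occ_weight_ge[OF assms(1,2)] m0 by auto
  define q where "q = Max (weight w N ` A)"
  have "q \<in> weight w N ` A" unfolding q_def using A by (intro Max_in) auto
  then have q1: "q \<in> weight w N ` occ f" by (auto simp: A_def)
  have q2: "weight w N m \<le> q" if "m \<in> occ f" for m
  proof (cases "m \<in> A")
    case False
    then have "weight w N m \<le> weight w N m0" using that by (auto simp: A_def)
    also have "\<dots> \<le> q" unfolding q_def using A by auto
    finally show ?thesis .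
  qed (use A in \<open>auto simp: q_def\<close>)
  have "max_weight w N f = q"
    unfolding max_weight_def by (rule Greatest_equality) (use q1 q2 in auto)
  then show "\<exists>m\<in>occ f. weight w N m = max_weight w N f"
    and "m \<in> occ f \<Longrightarrow> weight w N m \<le> max_weight w N f" using q1 q2 by auto
qed

lemma finite_max_weight:
  assumes "fst w < 0" "N > 0"
  shows "finite {m \<in> occ f. weight w N m = max_weight w N f}"
  by (rule finite_subset[OF _ finite_occ_weight_ge[OF assms]]) auto

lemma weight_inj:
  assumes "fst w < 0" "N > 0" "weight w N (\<alpha>, \<beta>) = weight w N (\<alpha>', \<beta>)"
  shows "\<alpha> = \<alpha>'"
  using assms by (simp add: weight_eq field_simps)

lemma lm_exists:
  assumes gt: "global_monomial_ordering gt" and w: "fst w < 0" "N > 0" and f: "f \<noteq> 0"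
  shows "\<exists>!m. m \<in> occ f \<and> (\<forall>m'\<in>occ f. m' \<noteq> m \<longrightarrow> gt_w gt w N m m')"
proof (rule ex_ex1I)
  have gt': "irreflp gt" "transp gt" "totalp gt"
    using gt by (auto simp: global_monomial_ordering_def)
  define A where "A = {m \<in> occ f. weight w N m = max_weight w N f}"
  have fin: "finite A" unfolding A_def by (rule finite_max_weight[OF w])
  have ne: "A \<noteq> {}" unfolding A_def using max_weight(1)[OF w f] by blast
  have "\<exists>m\<in>B. \<forall>m'\<in>B. snd m' = snd m \<or> gt (snd m) (snd m')" if "finite B" "B \<noteq> {}" for B :: "'a tmon set"
    using that
  proof (induction rule: finite_ne_induct)
    case (insert x F)
    then obtain m where m: "m \<in> F" "\<forall>m'\<in>F. snd m' = snd m \<or> gt (snd m) (snd m')" by blast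
    consider "snd x = snd m" | "gt (snd m) (snd x)" | "gt (snd x) (snd m)"
      using gt'(3) by (metis totalpD)
    then show ?case
    proof cases
      case 3
      then show ?thesis using m gt'(2) by (metis insert_iff transpD)
    qed (use m in auto)
  qed auto
  from this[OF fin ne] obtain m where m: "m \<in> A"
    "\<forall>m'\<in>A. snd m' = snd m \<or> gt (snd m) (snd m')" by blast
  show "\<exists>m. m \<in> occ f \<and> (\<forall>m'\<in>occ f. m' \<noteq> m \<longrightarrow> gt_w gt w N m m')"
  proof (intro exI conjI ballI impI)
    show "m \<in> occ f" using m by (simp add: A_def)
    fix m' assume m': "m' \<in> occ f" "m' \<noteq> m"
    show "gt_w gt w N m m'"
    proof (cases "m' \<in> A")
      case True
      then have eq: "weight w N m = weight w N m'" using m by (simp add: A_def)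
      have "snd m' \<noteq> snd m"
        using weight_inj[OF w, of "fst m" "snd m" "fst m'"] eq m'
        by (metis prod.collapse)
      then show ?thesis using m(2) True eq by (auto simp: gt_w_def)
    next
      case False
      then show ?thesis
        using max_weight(2)[OF w f m'(1)] m m' by (auto simp: gt_w_def A_def)
    qed
  qed
next
  fix m m' assume *: "m \<in> occ f \<and> (\<forall>m'\<in>occ f. m' \<noteq> m \<longrightarrow> gt_w gt w N m m')"
    "m' \<in> occ f \<and> (\<forall>m\<in>occ f. m \<noteq> m' \<longrightarrow> gt_w gt w N m' m)"
  show "m = m'"
  proof (rule ccontr)
    assume "m \<noteq> m'"
    then have "gt_w gt w N m m'" "gt_w gt w N m' m" using * by auto
    then have "gt (snd m) (snd m')" "gt (snd m') (snd m)" by (auto simp: gt_w_def)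
    then show False
      using gt unfolding global_monomial_ordering_def by (metis irreflpD transpD)
  qed
qed

lemma lookup_initial_form:
  assumes "fst w < 0" "N > 0"
  shows "Poly_Mapping.lookup (initial_form w N f) m =
    (if m \<in> occ f \<and> weight w N m = max_weight w N f then fps_nth (Poly_Mapping.lookup f (snd m)) (fst m) else 0)"
  unfolding initial_form_def lookup_sum lookup_single when_def
  using finite_max_weight[OF assms, of f] by (simp add: sum.delta)

lemma lookup_t_initial:
  assumes "fst w < 0" "N > 0"
  shows "(\<alpha>, \<beta>) \<in> occ f \<Longrightarrow> weight w N (\<alpha>, \<beta>) = max_weight w N f \<Longrightarrow>
      Poly_Mapping.lookup (t_initial w N f) \<beta> = fps_nth (Poly_Mapping.lookup f \<beta>) \<alpha>" (is "PROP ?A")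
    and "(\<And>\<alpha>. (\<alpha>, \<beta>) \<in> occ f \<Longrightarrow> weight w N (\<alpha>, \<beta>) \<noteq> max_weight w N f) \<Longrightarrow>
      Poly_Mapping.lookup (t_initial w N f) \<beta> = 0" (is "PROP ?B")
proof -
  let ?h = "initial_form w N f"
  have h: "m \<in> Poly_Mapping.keys ?h \<longleftrightarrow> m \<in> occ f \<and> weight w N m = max_weight w N f" for m
    by (auto simp: in_keys_iff lookup_initial_form[OF assms] occ_def)
  have eq: "Poly_Mapping.lookup (t_initial w N f) \<beta> = (\<Sum>m\<in>Poly_Mapping.keys ?h. if snd m = \<beta> then Poly_Mapping.lookup ?h m else 0)"
    unfolding t_initial_def subst_t_1_def lookup_sum lookup_single when_def by simp
  show "PROP ?A"
  proof -
    assume \<alpha>: "(\<alpha>, \<beta>) \<in> occ f" "weight w N (\<alpha>, \<beta>) = max_weight w N f"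
    have "snd m = \<beta> \<longleftrightarrow> m = (\<alpha>, \<beta>)" if "m \<in> Poly_Mapping.keys ?h" for m
      using that \<alpha> weight_inj[OF assms, of "fst m" \<beta> \<alpha>] unfolding h by (cases m) auto
    then have "Poly_Mapping.lookup (t_initial w N f) \<beta> =
        (\<Sum>m\<in>Poly_Mapping.keys ?h. if m = (\<alpha>, \<beta>) then Poly_Mapping.lookup ?h m else 0)"
      unfolding eq by (intro sum.cong) auto
    also have "\<dots> = Poly_Mapping.lookup ?h (\<alpha>, \<beta>)" using \<alpha> h by (simp add: sum.delta)
    finally show ?thesis using \<alpha> by (simp add: lookup_initial_form[OF assms])
  qed
  show "PROP ?B"
    unfolding eq by (rule sum.neutral) (auto simp: h)
qed

lemma lookup_shifted:
  fixes g :: "('n, 'a::field) Rx"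
  shows "Poly_Mapping.lookup (Poly_Mapping.single 0 c * Lx_of_Rx N g) \<beta> = c * puiseux_of_fps N (Poly_Mapping.lookup g \<beta>)"
  by (auto simp: Lx_of_Rx_def puiseux_of_fps_def puiseux_of_fls_0 map.rep_eq when_def
      simp flip: mult_map_scale_conv_mult)

lemma t_initial_unique:
  fixes g g' :: "('n::finite, 'a::field) Rx"
  assumes w: "fst w < 0" and N: "N > 0" "N' > 0"
    and eq: "Poly_Mapping.single 0 (puiseux_t_pow a) * Lx_of_Rx N g =
      Poly_Mapping.single 0 (puiseux_t_pow a') * Lx_of_Rx N' g'"
  shows "t_initial w N g = t_initial w N' g'"
proof -
  have step: "\<exists>k'. of_nat k' / of_nat N' = (of_nat k / of_nat N + a - a' :: rat) \<and>
      fps_nth (Poly_Mapping.lookup g' \<beta>) k' = fps_nth (Poly_Mapping.lookup g \<beta>) k"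
    if "N > 0" "N' > 0" "fps_nth (Poly_Mapping.lookup g \<beta>) k \<noteq> 0" and
      eq: "Poly_Mapping.single 0 (puiseux_t_pow a) * Lx_of_Rx N g =
        Poly_Mapping.single 0 (puiseux_t_pow a') * Lx_of_Rx N' g'"
    for g g' :: "('n, 'a) Rx" and a a' N N' \<beta> k
  proof -
    let ?q = "of_nat k / of_nat N + a :: rat"
    have "puiseux_nth (puiseux_of_fps N (Poly_Mapping.lookup g \<beta>)) (?q - a) =
        puiseux_nth (puiseux_of_fps N' (Poly_Mapping.lookup g' \<beta>)) (?q - a')"
      using eq by (metis lookup_shifted puiseux_nth_t_pow_mult)
    then have *: "puiseux_nth (puiseux_of_fps N' (Poly_Mapping.lookup g' \<beta>)) (?q - a') = fps_nth (Poly_Mapping.lookup g \<beta>) k"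
      using that by (simp add: puiseux_nth_of_fps)
    with that(3) have "puiseux_nth (puiseux_of_fps N' (Poly_Mapping.lookup g' \<beta>)) (?q - a') \<noteq> 0"
      by simp
    then obtain k' where k': "?q - a' = of_nat k' / of_nat N'"
      by (rule puiseux_nth_of_fps_nonzeroE)
    show ?thesis using * k' that unfolding k' puiseux_nth_of_fps[OF \<open>N' > 0\<close>] by auto
  qed
  have wt: "weight w N' (k', \<beta>) = weight w N (k, \<beta>) + fst w * of_rat (a - a')"
    if "of_nat k' / of_nat N' = (of_nat k / of_nat N + a - a' :: rat)" for k k' N N' a a' \<beta>
  proof -
    have "real k' / real N' = of_rat (of_nat k' / of_nat N' :: rat)" by (simp add: of_rat_divide)
    also have "\<dots> = real k / real N + of_rat (a - a')"
      unfolding that by (simp add: of_rat_add of_rat_diff of_rat_divide)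
    finally have *: "real k' / real N' = real k / real N + of_rat (a - a')" .
    have "fst w * real k' / real N' = fst w * (real k' / real N')" by simp
    then show ?thesis unfolding weight_eq * by (simp add: distrib_left)
  qed
  have main: "Poly_Mapping.lookup (t_initial w N' g') \<beta> = Poly_Mapping.lookup (t_initial w N g) \<beta>"
    if N: "N > 0" "N' > 0" and k: "(k, \<beta>) \<in> occ g" "weight w N (k, \<beta>) = max_weight w N g" and
      eq: "Poly_Mapping.single 0 (puiseux_t_pow a) * Lx_of_Rx N g =
        Poly_Mapping.single 0 (puiseux_t_pow a') * Lx_of_Rx N' g'"
    for g g' :: "('n, 'a) Rx" and a a' N N' \<beta> k
  proof -
    have k0: "fps_nth (Poly_Mapping.lookup g \<beta>) k \<noteq> 0" using k by (simp add: occ_def)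
    obtain k' where k': "of_nat k' / of_nat N' = (of_nat k / of_nat N + a - a' :: rat)"
      "fps_nth (Poly_Mapping.lookup g' \<beta>) k' = fps_nth (Poly_Mapping.lookup g \<beta>) k"
      using step[OF N k0 eq] by blast
    have occ': "(k', \<beta>) \<in> occ g'" using k' k0 by (simp add: occ_def)
    then have g': "g' \<noteq> 0" by (metis occ_eq_empty_iff empty_iff)
    from k have g: "g \<noteq> 0" by (metis occ_eq_empty_iff empty_iff)
    have "max_weight w N' g' \<le> weight w N' (k', \<beta>)"
    proof -
      obtain l' \<gamma> where l': "(l', \<gamma>) \<in> occ g'" "weight w N' (l', \<gamma>) = max_weight w N' g'"
        using max_weight(1)[OF w N(2) g'] by auto
      then have "fps_nth (Poly_Mapping.lookup g' \<gamma>) l' \<noteq> 0" by (simp add: occ_def)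
      from step[OF N(2,1) this eq[symmetric]] obtain l where
        l: "of_nat l / of_nat N = (of_nat l' / of_nat N' + a' - a :: rat)"
          "fps_nth (Poly_Mapping.lookup g \<gamma>) l = fps_nth (Poly_Mapping.lookup g' \<gamma>) l'" by blast
      have "(l, \<gamma>) \<in> occ g" using l l' by (simp add: occ_def)
      then have "weight w N (l, \<gamma>) \<le> weight w N (k, \<beta>)"
        using max_weight(2)[OF w N(1) g] k by simp
      moreover have "of_nat l' / of_nat N' = (of_nat l / of_nat N + a - a' :: rat)"
        using l(1) by simp
      note wt[OF this, of \<gamma>]
      ultimately show ?thesis using wt[OF k'(1), of \<beta>] l' by simp
    qed
    then have max': "weight w N' (k', \<beta>) = max_weight w N' g'"
      using max_weight(2)[OF w N(2) g' occ'] by simp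
    show ?thesis
      using lookup_t_initial(1)[OF w N(2) occ' max'] lookup_t_initial(1)[OF w N(1) k] k' by simp
  qed
  show ?thesis
  proof (rule poly_mapping_eqI)
    fix \<beta>
    consider k where "(k, \<beta>) \<in> occ g" "weight w N (k, \<beta>) = max_weight w N g"
      | k where "(k, \<beta>) \<in> occ g'" "weight w N' (k, \<beta>) = max_weight w N' g'"
      | "\<And>k. (k, \<beta>) \<in> occ g \<Longrightarrow> weight w N (k, \<beta>) \<noteq> max_weight w N g"
        "\<And>k. (k, \<beta>) \<in> occ g' \<Longrightarrow> weight w N' (k, \<beta>) \<noteq> max_weight w N' g'"
      by blast
    then show "Poly_Mapping.lookup (t_initial w N g) \<beta> = Poly_Mapping.lookup (t_initial w N' g') \<beta>"
    proof cases
      case 1 show ?thesis by (rule main[OF N 1 eq, symmetric])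
    next
      case 2 show ?thesis by (rule main[OF N(2,1) 2 eq[symmetric]])
    next
      case 3 show ?thesis
        using lookup_t_initial(2)[OF w N(1) 3(1)] lookup_t_initial(2)[OF w N(2) 3(2)] by simp
    qed
  qed
qed

lemma puiseux_t_pow_inverse: "puiseux_t_pow (- r) * (puiseux_t_pow r * f) = f"
  by (rule puiseux_eqI) (simp only: puiseux_nth_t_pow_mult diff_minus_eq_add add_diff_cancel_right')

lemma puiseux_common_denominator:
  fixes A :: "'a::comm_ring_1 puiseux set"
  assumes "finite A"
  shows "\<exists>N>0. \<exists>\<alpha>. \<forall>f\<in>A. \<exists>F. puiseux_t_pow (of_nat \<alpha> / of_nat N) * f = puiseux_of_fps N F"
proof -
  have "\<exists>N>0. \<forall>f\<in>A. \<forall>M>0. \<exists>F. f = puiseux_of_fls (N * M) F"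
    using assms
  proof (induction)
    case (insert f A)
    then obtain N where N: "N > 0" "\<And>f M. f \<in> A \<Longrightarrow> M > 0 \<Longrightarrow> \<exists>F. f = puiseux_of_fls (N * M) F"
      by blast
    obtain P where P: "P > 0" "\<And>M. M > 0 \<Longrightarrow> \<exists>F. puiseux_nth f = stretch (P * M) F"
      using stretch_refine[OF puiseux_is_puiseux] by blast
    have P': "\<exists>F. f = puiseux_of_fls (P * M) F" if "M > 0" for M
      using P(2)[OF that] by (metis puiseux_eqI puiseux_of_fls.rep_eq)
    show ?case
    proof (intro exI[of _ "N * P"] conjI ballI allI impI)
      fix g and M :: nat assume g: "g \<in> insert f A" and M: "M > 0"
      have "N * P * M = N * (P * M)" "N * P * M = P * (N * M)" by simp_all
      then show "\<exists>F. g = puiseux_of_fls (N * P * M) F"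
        using g N(2)[of g "P * M"] P'[of "N * M"] N(1) P(1) M by (metis insertE mult_pos_pos)
    qed (use N P in simp)
  qed auto
  then obtain N where N: "N > 0" "\<forall>f\<in>A. \<exists>F. f = puiseux_of_fls N F"
    by (metis mult.right_neutral zero_less_one)
  then obtain F where F: "\<And>f. f \<in> A \<Longrightarrow> f = puiseux_of_fls N (F f)" by metis
  define \<alpha> where "\<alpha> = (\<Sum>f\<in>A. nat (- fls_subdegree (F f)))"
  have "\<exists>G. puiseux_t_pow (of_nat \<alpha> / of_nat N) * f = puiseux_of_fps N G" if f: "f \<in> A" for f
  proof -
    have "nat (- fls_subdegree (F f)) \<le> \<alpha>" unfolding \<alpha>_def using assms f by (intro member_le_sum) auto
    then have sub: "- int \<alpha> \<le> fls_subdegree (F f)" by linarith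
    define G where "G = Abs_fps (\<lambda>k. fls_nth (F f) (int k - int \<alpha>))"
    have G: "fps_to_fls G = fls_shift (- int \<alpha>) (F f)"
      by (rule fls_eqI) (use sub in \<open>auto simp: G_def\<close>)
    have "puiseux_t_pow (of_nat \<alpha> / of_nat N) * f = puiseux_of_fps N G"
    proof (rule puiseux_eqI)
      fix q
      let ?q = "q - of_nat \<alpha> / of_nat N :: rat"
      have *: "?q * of_nat N = q * of_nat N - of_int (int \<alpha>)"
        using N by (simp add: left_diff_distrib)
      have "q * of_nat N - of_int (int \<alpha>) \<in> \<int> \<longleftrightarrow> q * of_nat N \<in> \<int>"
        by (metis Ints_add Ints_diff Ints_of_int diff_add_cancel)
      then have "stretch N (F f) ?q = stretch N (fls_shift (- int \<alpha>) (F f)) q"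
        unfolding stretch_def * using floor_diff_of_int[of "q * of_nat N" "int \<alpha>"] by simp
      then show "puiseux_nth (puiseux_t_pow (of_nat \<alpha> / of_nat N) * f) q =
          puiseux_nth (puiseux_of_fps N G) q"
        unfolding puiseux_nth_t_pow_mult puiseux_of_fps_def G
        using F[OF f] by (metis puiseux_of_fls.rep_eq)
    qed
    then show ?thesis ..
  qed
  then show ?thesis using N by blast
qed

lemma Lx_representation:
  fixes f :: "('n, 'a::field) Lx"
  obtains N \<alpha> g where "N > 0"
    "f = Poly_Mapping.single 0 (puiseux_t_pow (- (of_nat \<alpha> / of_nat N))) * Lx_of_Rx N g"
proof -
  obtain N \<alpha> where N: "N > 0"
    and *: "\<forall>c\<in>Poly_Mapping.lookup f ` Poly_Mapping.keys f. \<exists>F. puiseux_t_pow (of_nat \<alpha> / of_nat N) * c = puiseux_of_fps N F"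
    using puiseux_common_denominator[of "Poly_Mapping.lookup f ` Poly_Mapping.keys f"] by auto
  then obtain F where F:
    "\<And>c. c \<in> Poly_Mapping.lookup f ` Poly_Mapping.keys f \<Longrightarrow> puiseux_t_pow (of_nat \<alpha> / of_nat N) * c = puiseux_of_fps N (F c)"
    by metis
  define g where "g = Poly_Mapping.mapp (\<lambda>_. F) f"
  have "f = Poly_Mapping.single 0 (puiseux_t_pow (- (of_nat \<alpha> / of_nat N))) * Lx_of_Rx N g"
  proof (rule poly_mapping_eqI)
    fix \<beta>
    show "Poly_Mapping.lookup f \<beta> =
      Poly_Mapping.lookup (Poly_Mapping.single 0 (puiseux_t_pow (- (of_nat \<alpha> / of_nat N))) * Lx_of_Rx N g) \<beta>"
    proof (cases "\<beta> \<in> Poly_Mapping.keys f")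
      case True
      then have "Poly_Mapping.lookup g \<beta> = F (Poly_Mapping.lookup f \<beta>)" by (simp add: g_def lookup_mapp)
      then have "puiseux_of_fps N (Poly_Mapping.lookup g \<beta>) = puiseux_t_pow (of_nat \<alpha> / of_nat N) * Poly_Mapping.lookup f \<beta>"
        using F True by simp
      then show ?thesis unfolding lookup_shifted by (simp only: puiseux_t_pow_inverse)
    next
      case False
      then have "Poly_Mapping.lookup g \<beta> = 0" "Poly_Mapping.lookup f \<beta> = 0" by (simp_all add: g_def lookup_mapp in_keys_iff)
      then show ?thesis unfolding lookup_shifted by (simp add: puiseux_of_fps_def puiseux_of_fls_0)
    qed
  qed
  then show thesis using that N by blast
qed

lemma t_initial_L_eq:
  assumes "fst w < 0" "N > 0"
    "f = Poly_Mapping.single 0 (puiseux_t_pow (- (of_nat \<alpha> / of_nat N))) * Lx_of_Rx N g"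
  shows "t_initial_L w f = t_initial w N g"
  unfolding t_initial_L_def
proof (rule the_equality)
  show "\<exists>M \<alpha>' g'. M > 0 \<and>
      f = Poly_Mapping.single 0 (puiseux_t_pow (- (of_nat \<alpha>' / of_nat M))) * Lx_of_Rx M g' \<and>
      t_initial w N g = t_initial w M g'"
    using assms by blast
qed (use assms t_initial_unique in metis)

end

theory Submission
  imports Defs
begin

text \<open>
  Both equalities are about the absence of cancellation among terms of maximal weight.

  For a real \<open>\<mu>\<close>, the part of weight \<open>\<mu>\<close> of a polynomial, with \<open>t = 1\<close> substituted, is additive in the
  polynomial (\<open>weight_part\<close> over \<open>R\<^sub>N\<close>, \<open>weight_part_L\<close> over \<open>L\<close>), and the \<open>t\<close>-initial form is the
  part of maximal weight.  Hence a part whose weight bounds all weights from above is the \<open>t\<close>-initial form or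
  zero, and no information is lost because \<open>w\<^sub>0 \<noteq> 0\<close>: for a given \<open>x\<^sup>\<beta>\<close> at most one power of \<open>t\<close>
  has weight \<open>\<mu>\<close>.

  The ideal of the standard basis (\<open>t_initial_ideal_standard_basis\<close>): if the leading monomial of \<open>f \<in> I\<close> has
  weight \<open>\<mu>\<close>, it is divisible by the leading monomial of some \<open>g \<in> G\<close>, and subtracting a term multiple of
  \<open>g\<close> gives zero or an element of \<open>I\<close> with a smaller leading monomial.  The part of weight \<open>\<mu>\<close> changes by a
  term multiple of the \<open>t\<close>-initial form of \<open>g\<close>.  As long as the weight stays \<open>\<mu>\<close>, it is the
  \<open>x\<close>-part of the leading monomial that decreases; a global ordering on monomials in finitely many variables is
  well-founded, so after finitely many steps nothing of weight \<open>\<mu>\<close> is left.  The reduction may well go on for ever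
  in lower weights, but those do not matter.

  The ideal over \<open>L\<close> (\<open>t_initial_ideal_extended\<close>): splitting the exponents of \<open>t\<close> into classes
  modulo \<open>1/N\<close> writes every \<open>f \<in> J\<close> as a finite sum of \<open>t\<^sup>q g\<^sub>q\<close> with \<open>g\<^sub>q \<in> I\<close> and
  pairwise incongruent \<open>q\<close>, which reflects that the \<open>t\<^sup>j\<^sup>/\<^sup>N\<^sup>M\<close> with
  \<open>0 \<le> j < M\<close> form a basis of \<open>L\<^sub>N\<^sub>M\<close> over \<open>L\<^sub>N\<close>.  The summands have no monomial in common, so
  each of them inherits the upper bound on the weights of \<open>f\<close>, and the part of \<open>f\<close> of maximal weight is the sum
  of the \<open>t\<close>-initial forms of those \<open>g\<^sub>q\<close> that reach the bound.
\<close>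

section \<open>Multiplication by a term\<close>

lemma sum_single_lookup: "(\<Sum>k\<in>Poly_Mapping.keys p. Poly_Mapping.single k (Poly_Mapping.lookup p k)) = p"
  for p :: "'k \<Rightarrow>\<^sub>0 'b::comm_monoid_add"
  by (rule poly_mapping_eqI) (simp add: lookup_sum lookup_single when_def in_keys_iff)

lemma lookup_single_mult_add:
  fixes p :: "'k::cancel_comm_monoid_add \<Rightarrow>\<^sub>0 'b::comm_semiring_0"
  shows "Poly_Mapping.lookup (Poly_Mapping.single k c * p) (k + l) = c * Poly_Mapping.lookup p l"
proof -
  have "Poly_Mapping.single k c * p =
      (\<Sum>j\<in>Poly_Mapping.keys p. Poly_Mapping.single (k + j) (c * Poly_Mapping.lookup p j))"
    by (subst sum_single_lookup[of p, symmetric]) (simp only: sum_distrib_left mult_single)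
  then show ?thesis
    by (simp add: lookup_sum lookup_single when_def in_keys_iff)
qed

lemma lookup_single_mult_eq_0:
  fixes p :: "'k::cancel_comm_monoid_add \<Rightarrow>\<^sub>0 'b::comm_semiring_0"
  assumes "\<And>l. m \<noteq> k + l"
  shows "Poly_Mapping.lookup (Poly_Mapping.single k c * p) m = 0"
proof (rule ccontr)
  assume "\<not> ?thesis"
  then have "m \<in> Poly_Mapping.keys (Poly_Mapping.single k c * p)" by (simp add: in_keys_iff)
  with keys_mult[of "Poly_Mapping.single k c" p] assms show False by (auto split: if_splits)
qed

section \<open>Global orderings are well-founded\<close>

text \<open>
  Dickson's lemma.  One coordinate is treated at a time: passing repeatedly to the index at which the remaining values
  are smallest makes it nondecreasing, and subsequences of nondecreasing sequences stay nondecreasing.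
\<close>

lemma increasing_subsequence_coordinates:
  fixes s :: "nat \<Rightarrow> 'n \<Rightarrow> nat"
  assumes "finite A"
  shows "\<exists>r::nat \<Rightarrow> nat. strict_mono r \<and> (\<forall>i\<in>A. incseq (\<lambda>n. s (r n) i))"
  using assms
proof induction
  case empty
  show ?case by (rule exI[of _ id]) (simp add: strict_mono_def)
next
  case (insert i A)
  then obtain r where r: "strict_mono r" "\<forall>i\<in>A. incseq (\<lambda>n. s (r n) i)" by blast
  define v where "v n = s (r n) i" for n
  have ex: "\<exists>m>n. \<forall>k>n. v m \<le> v k" for n
  proof -
    obtain m where "m > n" "\<forall>k. k > n \<longrightarrow> v m \<le> v k"
      using ex_has_least_nat[of "\<lambda>m. m > n" "Suc n" v] by auto
    then show ?thesis by blast
  qed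
  then obtain nx where nx: "\<And>n. nx n > n" "\<And>n k. k > n \<Longrightarrow> v (nx n) \<le> v k" by metis
  define u where "u n = (nx ^^ Suc n) 0" for n
  have u: "strict_mono u" by (rule strict_mono_Suc_iff[THEN iffD2]) (simp add: u_def nx)
  have "incseq (\<lambda>n. v (u n))"
  proof (rule incseq_SucI)
    fix n
    have "u n = nx ((nx ^^ n) 0)" by (simp add: u_def)
    moreover have "(nx ^^ n) 0 < u n" "u n < u (Suc n)" by (simp_all add: u_def nx)
    ultimately show "v (u n) \<le> v (u (Suc n))" using nx(2) by (metis less_trans)
  qed
  moreover have "incseq (\<lambda>n. s (r (u n)) j)" if "j \<in> A" for j
    using r(2) that u by (auto simp: incseq_def strict_mono_less_eq)
  moreover have "strict_mono (\<lambda>n. r (u n))" using r(1) u by (simp add: strict_mono_def)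
  ultimately show ?case by (intro exI[of _ "\<lambda>n. r (u n)"]) (auto simp: v_def)
qed

lemma global_monomial_ordering_pos:
  assumes gt: "global_monomial_ordering gt"
  shows "c = 0 \<or> gt c 0"
proof (induction "sum (Poly_Mapping.lookup c) (Poly_Mapping.keys c)" arbitrary: c)
  case 0
  then have "c = 0" by (auto simp: in_keys_iff intro!: poly_mapping_eqI)
  then show ?case by simp
next
  case (Suc n)
  then obtain i where i: "i \<in> Poly_Mapping.keys c" by fastforce
  define d where "d = c - Poly_Mapping.single i 1"
  have c: "c = d + Poly_Mapping.single i 1"
    using i by (intro poly_mapping_eqI)
      (auto simp: d_def lookup_add lookup_minus lookup_single when_def in_keys_iff)
  have "sum (Poly_Mapping.lookup c) (Poly_Mapping.keys c) = sum (Poly_Mapping.lookup d) (Poly_Mapping.keys c) + 1"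
    using i by (subst c) (simp add: lookup_add sum.distrib lookup_single when_def)
  also have "sum (Poly_Mapping.lookup d) (Poly_Mapping.keys c) = sum (Poly_Mapping.lookup d) (Poly_Mapping.keys d)"
    by (rule sum.mono_neutral_right) (use c in \<open>auto simp: in_keys_iff lookup_add\<close>)
  finally have "d = 0 \<or> gt d 0" using Suc by auto
  moreover have e: "gt (Poly_Mapping.single i 1) 0"
    and "gt d 0 \<Longrightarrow> gt (d + Poly_Mapping.single i 1) (0 + Poly_Mapping.single i 1)" and "transp gt"
    using gt unfolding global_monomial_ordering_def by blast+
  ultimately show ?case unfolding c by (metis add_0 transpD)
qed

text \<open>
  In an infinite descending chain, Dickson's lemma finds a monomial that divides a later one; but multiples are never
  smaller.
\<close>

lemma wfp_global_monomial_ordering: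
  fixes gt :: "'n::finite mon \<Rightarrow> 'n mon \<Rightarrow> bool"
  assumes gt: "global_monomial_ordering gt"
  shows "wfp (\<lambda>a b. gt b a)"
  unfolding wfp_def wf_iff_no_infinite_down_chain
proof (rule notI, elim exE)
  fix s :: "nat \<Rightarrow> 'n mon" assume "\<forall>i. (s (Suc i), s i) \<in> {(a, b). gt b a}"
  then have dec: "gt (s i) (s (Suc i))" for i by simp
  have gt': "irreflp gt" "transp gt" "\<And>a b c. gt a b \<Longrightarrow> gt (a + c) (b + c)"
    using gt by (auto simp: global_monomial_ordering_def)
  have down: "gt (s i) (s j)" if "i < j" for i j
    using that by (induction rule: less_Suc_induct) (use dec gt'(2) in \<open>auto dest: transpD\<close>)
  obtain r where r: "strict_mono r" "\<And>i. incseq (\<lambda>n. Poly_Mapping.lookup (s (r n)) i)"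
    using increasing_subsequence_coordinates[of "UNIV :: 'n set" "\<lambda>n. Poly_Mapping.lookup (s n)"]
    by auto
  define c where "c = s (r 1) - s (r 0)"
  have c: "s (r 1) = c + s (r 0)"
    unfolding c_def
    by (rule poly_mapping_eqI) (use r(2) in \<open>simp add: lookup_add lookup_minus incseq_def\<close>)
  have "s (r 1) = s (r 0) \<or> gt (s (r 1)) (s (r 0))"
    using global_monomial_ordering_pos[OF gt, of c] gt'(3)[of c 0 "s (r 0)"]
    unfolding c by auto
  moreover have "gt (s (r 0)) (s (r 1))" using down r(1) by (simp add: strict_mono_def)
  ultimately show False using gt'(1,2) by (metis irreflpD transpD)
qed

section \<open>The part of a given weight\<close>

text \<open>
  The coefficient of \<open>x\<^sup>\<beta>\<close> is a sum over at most one \<open>\<alpha>\<close>, since \<open>w\<^sub>0 \<noteq> 0\<close>.  Writing it as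
  a sum makes additivity evident and gives the value zero when no \<open>\<alpha>\<close> exists.
\<close>

definition weight_part :: "real \<times> (real ^ 'n) \<Rightarrow> nat \<Rightarrow> real \<Rightarrow> ('n::finite, 'a::field) Rx \<Rightarrow> ('n, 'a) Kx" where
  "weight_part w N \<mu> f = Poly_Mapping.mapp (\<lambda>\<beta> F. \<Sum>\<alpha> | weight w N (\<alpha>, \<beta>) = \<mu>. fps_nth F \<alpha>) f"

lemma lookup_weight_part:
  "Poly_Mapping.lookup (weight_part w N \<mu> f) \<beta> =
     (\<Sum>\<alpha> | weight w N (\<alpha>, \<beta>) = \<mu>. fps_nth (Poly_Mapping.lookup f \<beta>) \<alpha>)"
  by (simp add: weight_part_def lookup_mapp when_def in_keys_iff)

lemma weight_part_diff: "weight_part w N \<mu> (f - g) = weight_part w N \<mu> f - weight_part w N \<mu> g"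
  by (rule poly_mapping_eqI) (simp add: lookup_weight_part lookup_minus sum_subtractf)

lemma lookup_weight_part_at:
  assumes "fst w < 0" "N > 0" "weight w N (\<alpha>, \<beta>) = \<mu>"
  shows "Poly_Mapping.lookup (weight_part w N \<mu> f) \<beta> = fps_nth (Poly_Mapping.lookup f \<beta>) \<alpha>"
proof -
  have "{\<alpha>'. weight w N (\<alpha>', \<beta>) = \<mu>} = {\<alpha>}"
    using assms weight_inj[OF assms(1,2)] by blast
  then show ?thesis by (simp add: lookup_weight_part)
qed

lemma lookup_weight_part_eq_0:
  assumes "\<And>\<alpha>. (\<alpha>, \<beta>) \<in> occ f \<Longrightarrow> weight w N (\<alpha>, \<beta>) \<noteq> \<mu>"
  shows "Poly_Mapping.lookup (weight_part w N \<mu> f) \<beta> = 0"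
  unfolding lookup_weight_part by (rule sum.neutral) (use assms in \<open>auto simp: occ_def\<close>)

lemma t_initial_eq_weight_part:
  assumes "fst w < 0" "N > 0"
  shows "t_initial w N f = weight_part w N (max_weight w N f) f"
proof (rule poly_mapping_eqI)
  fix \<beta>
  show "Poly_Mapping.lookup (t_initial w N f) \<beta> =
      Poly_Mapping.lookup (weight_part w N (max_weight w N f) f) \<beta>"
  proof (cases "\<exists>\<alpha>. (\<alpha>, \<beta>) \<in> occ f \<and> weight w N (\<alpha>, \<beta>) = max_weight w N f")
    case True
    then show ?thesis
      using lookup_t_initial(1)[OF assms] lookup_weight_part_at[OF assms] by metis
  next
    case False
    then show ?thesis
      using lookup_t_initial(2)[OF assms] lookup_weight_part_eq_0 by metis
  qed
qed

lemma weight_part_eq_0: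
  assumes "\<And>m. m \<in> occ f \<Longrightarrow> weight w N m < \<mu>"
  shows "weight_part w N \<mu> f = 0"
  by (rule poly_mapping_eqI, subst lookup_weight_part_eq_0) (use assms in force)+

lemma t_initial_0: "fst w < 0 \<Longrightarrow> N > 0 \<Longrightarrow> t_initial w N 0 = 0"
  by (simp only: t_initial_eq_weight_part) (simp add: weight_part_def poly_mapping_eq_iff lookup_mapp fun_eq_iff)

text \<open>
  This replaces case distinctions on how the maximal weight behaves under sums: an upper bound can be carried along,
  and whether it is attained is asked only at the end.
\<close>

lemma weight_part_upper_bound:
  assumes w: "fst w < 0" "N > 0" and le: "\<And>m. m \<in> occ f \<Longrightarrow> weight w N m \<le> \<mu>"
  shows "weight_part w N \<mu> f = 0 \<or> weight_part w N \<mu> f = t_initial w N f"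
proof (cases "f \<noteq> 0 \<and> max_weight w N f = \<mu>")
  case True
  then have "weight_part w N \<mu> f = t_initial w N f"
    by (simp only: t_initial_eq_weight_part[OF w])
  then show ?thesis ..
next
  case False
  have "weight w N m < \<mu>" if m: "m \<in> occ f" for m
  proof -
    have f: "f \<noteq> 0" using m occ_eq_empty_iff by blast
    then obtain m' where "m' \<in> occ f" "weight w N m' = max_weight w N f"
      using max_weight(1)[OF w f] by auto
    then have "max_weight w N f < \<mu>" using le[of m'] f False by auto
    then show ?thesis using max_weight(2)[OF w f m] by simp
  qed
  then show ?thesis using weight_part_eq_0 by blast
qed

lemma weight_add: "weight w N (m + m') = weight w N m + weight w N m'"
proof -
  have "(\<chi> i. real (Poly_Mapping.lookup (snd (m + m')) i)) =
      (\<chi> i. real (Poly_Mapping.lookup (snd m) i)) + (\<chi> i. real (Poly_Mapping.lookup (snd m') i))"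
    by (simp add: vec_eq_iff lookup_add)
  then show ?thesis
    by (simp add: weight_def inner_prod_def inner_add_right add_divide_distrib algebra_simps)
qed

lemma gt_w_add:
  assumes "global_monomial_ordering gt" "gt_w gt w N m m'"
  shows "gt_w gt w N (d + m) (d + m')"
  using assms by (auto simp: gt_w_def weight_add global_monomial_ordering_def add.commute[of "snd d"])

definition term_mult :: "'n tmon \<Rightarrow> 'a::field \<Rightarrow> ('n, 'a) Rx \<Rightarrow> ('n, 'a) Rx" where
  "term_mult d c g = Poly_Mapping.single (snd d) (fps_const c * fps_X ^ fst d) * g"

lemma lookup_term_mult:
  "Poly_Mapping.lookup (term_mult d c g) (snd d + \<beta>) = fps_const c * (fps_X ^ fst d * Poly_Mapping.lookup g \<beta>)"
  by (simp only: term_mult_def lookup_single_mult_add mult.assoc)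

lemma coeff_term_mult:
  "fps_nth (Poly_Mapping.lookup (term_mult d c g) (snd d + \<beta>)) (fst d + \<alpha>) =
     c * fps_nth (Poly_Mapping.lookup g \<beta>) \<alpha>"
  by (simp only: lookup_term_mult fps_mult_left_const_nth fps_X_power_mult_nth) simp

lemma occ_term_mult: "occ (term_mult d c g) \<subseteq> (+) d ` occ g"
proof clarify
  fix \<alpha> \<beta> assume *: "(\<alpha>, \<beta>) \<in> occ (term_mult d c g)"
  obtain \<beta>' where \<beta>: "\<beta> = snd d + \<beta>'"
  proof (rule ccontr)
    assume "\<not> thesis"
    then have "\<beta> \<noteq> snd d + \<beta>'" for \<beta>' using that by blast
    then have "Poly_Mapping.lookup (term_mult d c g) \<beta> = 0"
      unfolding term_mult_def by (rule lookup_single_mult_eq_0)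
    with * show False by (simp add: occ_def)
  qed
  have "\<alpha> \<ge> fst d"
  proof (rule ccontr)
    assume "\<not> ?thesis"
    then have "fps_nth (Poly_Mapping.lookup (term_mult d c g) \<beta>) \<alpha> = 0"
      unfolding \<beta> lookup_term_mult fps_mult_left_const_nth fps_X_power_mult_nth by simp
    with * show False by (simp add: occ_def)
  qed
  then obtain \<alpha>' where \<alpha>: "\<alpha> = fst d + \<alpha>'" using le_Suc_ex by blast
  from * have "(\<alpha>', \<beta>') \<in> occ g" unfolding \<alpha> \<beta> by (auto simp: occ_def coeff_term_mult)
  then show "(\<alpha>, \<beta>) \<in> (+) d ` occ g" unfolding \<alpha> \<beta> by (metis image_eqI add_Pair prod.collapse)
qed

text \<open>Multiplication by a term shifts all weights by the same amount and so permutes the weight parts.\<close>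

lemma weight_part_term_mult:
  assumes w: "fst w < 0" "N > 0"
  shows "weight_part w N (weight w N d + \<mu>) (term_mult d c g) =
    Poly_Mapping.single (snd d) c * weight_part w N \<mu> g"
proof (rule poly_mapping_eqI)
  fix \<beta>
  consider (shift) \<beta>' where "\<beta> = snd d + \<beta>'" | (none) "\<And>\<beta>'. \<beta> \<noteq> snd d + \<beta>'" by blast
  then show "Poly_Mapping.lookup (weight_part w N (weight w N d + \<mu>) (term_mult d c g)) \<beta> =
    Poly_Mapping.lookup (Poly_Mapping.single (snd d) c * weight_part w N \<mu> g) \<beta>"
  proof cases
    case shift
    have add: "weight w N (fst d + \<alpha>, snd d + \<beta>') = weight w N d + weight w N (\<alpha>, \<beta>')" for \<alpha>
      using weight_add[of w N d "(\<alpha>, \<beta>')"] by (cases d) simp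
    show ?thesis
    proof (cases "\<exists>\<alpha>. weight w N (\<alpha>, \<beta>') = \<mu>")
      case True
      then obtain \<alpha> where \<alpha>: "weight w N (\<alpha>, \<beta>') = \<mu>" ..
      then have "weight w N (fst d + \<alpha>, snd d + \<beta>') = weight w N d + \<mu>" by (simp add: add)
      then show ?thesis
        unfolding shift lookup_single_mult_add
        by (simp add: lookup_weight_part_at[OF w] lookup_weight_part_at[OF w \<alpha>] coeff_term_mult)
    next
      case False
      then have "Poly_Mapping.lookup (weight_part w N \<mu> g) \<beta>' = 0"
        by (intro lookup_weight_part_eq_0) blast
      moreover have "Poly_Mapping.lookup (weight_part w N (weight w N d + \<mu>) (term_mult d c g)) \<beta> = 0"
      proof (rule lookup_weight_part_eq_0)
        fix \<alpha> assume "(\<alpha>, \<beta>) \<in> occ (term_mult d c g)"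
        then obtain m where "m \<in> occ g" "(\<alpha>, \<beta>) = d + m" using occ_term_mult by blast
        then obtain \<alpha>' where "(\<alpha>, \<beta>) = (fst d + \<alpha>', snd d + \<beta>')" 
          unfolding shift by (cases d; cases m) auto
        then show "weight w N (\<alpha>, \<beta>) \<noteq> weight w N d + \<mu>" using add False by auto
      qed
      ultimately show ?thesis unfolding shift lookup_single_mult_add by simp
    qed
  next
    case none
    have "(\<alpha>, \<beta>) \<noteq> d + m" for \<alpha> m using none by (cases d; cases m) auto
    then have "Poly_Mapping.lookup (weight_part w N (weight w N d + \<mu>) (term_mult d c g)) \<beta> = 0"
      by (intro lookup_weight_part_eq_0) (use occ_term_mult in blast)
    then show ?thesis using none by (simp add: lookup_single_mult_eq_0)
  qed
qed

section \<open>Leading monomials\<close>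

definition lead ::
  "('n::finite mon \<Rightarrow> 'n mon \<Rightarrow> bool) \<Rightarrow> real \<times> (real ^ 'n) \<Rightarrow> nat \<Rightarrow> ('n, 'a::field) Rx \<Rightarrow> 'n tmon"
where
  "lead gt w N f = (THE m. m \<in> occ f \<and> (\<forall>m'\<in>occ f. m' \<noteq> m \<longrightarrow> gt_w gt w N m m'))"

lemma lm_eq_single_lead: "f \<noteq> 0 \<Longrightarrow> lm gt w N f = Poly_Mapping.single (lead gt w N f) 1"
  by (simp add: lm_def lead_def)

lemma lead:
  assumes "global_monomial_ordering gt" "fst w < 0" "N > 0" "f \<noteq> 0"
  shows lead_in_occ: "lead gt w N f \<in> occ f"
    and lead_greatest: "m \<in> occ f \<Longrightarrow> m \<noteq> lead gt w N f \<Longrightarrow> gt_w gt w N (lead gt w N f) m"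
  using theI'[OF lm_exists[OF assms]] unfolding lead_def by blast+

lemma weight_le_lead:
  assumes "global_monomial_ordering gt" "fst w < 0" "N > 0" "f \<noteq> 0" "m \<in> occ f"
  shows "weight w N m \<le> weight w N (lead gt w N f)"
  using lead_greatest[OF assms] by (cases "m = lead gt w N f") (auto simp: gt_w_def)

lemma t_initial_eq_weight_part_lead:
  assumes gt: "global_monomial_ordering gt" and w: "fst w < 0" "N > 0" and f: "f \<noteq> 0"
  shows "t_initial w N f = weight_part w N (weight w N (lead gt w N f)) f"
proof -
  have "max_weight w N f = weight w N (lead gt w N f)"
    using max_weight[OF w f] weight_le_lead[OF gt w f] lead_in_occ[OF gt w f] by (metis order_antisym)
  then show ?thesis using t_initial_eq_weight_part[OF w] by metis
qed

text \<open>The polynomials all of whose monomials are divisible by an element of \<open>M\<close> form an ideal.\<close>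

lemma monomial_ideal_membership:
  fixes M :: "'k::cancel_comm_monoid_add set" and p :: "'k \<Rightarrow>\<^sub>0 'b::comm_ring_1"
  assumes "p \<in> ideal_gen ((\<lambda>m. Poly_Mapping.single m 1) ` M)" "k \<in> Poly_Mapping.keys p"
  shows "\<exists>m\<in>M. \<exists>d. k = d + m"
  using assms
proof (induction arbitrary: k rule: ideal.span_induct_alt)
  case base
  then show ?case by simp
next
  case (step c x y)
  from step.hyps obtain m where m: "m \<in> M" "x = Poly_Mapping.single m 1" by blast
  from step.prems keys_add[of "c * x" y] keys_mult[of c x]
  have "k \<in> Poly_Mapping.keys y \<or> (\<exists>a\<in>Poly_Mapping.keys c. k = a + m)" unfolding m(2) by auto
  then show ?case using step.IH m by blast
qed

lemma standard_basis_lead_divides: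
  assumes sb: "standard_basis gt w N I G" and f: "f \<in> I" "f \<noteq> 0"
  shows "\<exists>g\<in>G. g \<noteq> 0 \<and> (\<exists>d. lead gt w N f = d + lead gt w N g)"
proof -
  let ?S = "(\<lambda>m. Poly_Mapping.single m 1) ` lead gt w N ` (G - {0})"
  have "lm gt w N g \<in> ideal_gen ?S" if "g \<in> G" for g
  proof (cases "g = 0")
    case True
    then show ?thesis by (simp add: lm_def ideal.span_zero)
  next
    case False
    then show ?thesis using that by (intro ideal.span_base) (auto simp: lm_eq_single_lead)
  qed
  then have "ideal_gen (lm gt w N ` G) \<subseteq> ideal_gen ?S"
    by (intro ideal.span_minimal) auto
  moreover have "lm gt w N f \<in> ideal_gen (lm gt w N ` G)"
    using sb f(1) unfolding standard_basis_def leading_ideal_def by (simp add: ideal.span_base)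
  ultimately have "Poly_Mapping.single (lead gt w N f) 1 \<in> ideal_gen (?S :: ('a, 'b) Ktx set)"
    using f(2) by (auto simp: lm_eq_single_lead)
  from monomial_ideal_membership[OF this, of "lead gt w N f"] show ?thesis by auto
qed

section \<open>Reduction modulo a standard basis\<close>

text \<open>
  The induction runs over the \<open>x\<close>-part of the leading monomial of those \<open>h \<in> I\<close> whose leading monomial has
  weight exactly \<open>\<mu>\<close>.  Cancelling it against a term multiple of a basis element either makes all weights smaller
  than \<open>\<mu>\<close>, so that the part of weight \<open>\<mu>\<close> vanishes, or leaves a leading monomial of the same weight, which
  is then smaller in the given ordering of \<open>x\<close>-monomials.
\<close>

lemma weight_part_in_ideal:
  fixes gt :: "'n::finite mon \<Rightarrow> 'n mon \<Rightarrow> bool" and I G :: "('n, 'a::field) Rx set"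
  assumes gt: "global_monomial_ordering gt" and w: "fst w < 0" "N > 0"
    and I: "is_ideal I" and sb: "standard_basis gt w N I G"
    and f: "f \<in> I" and le: "\<And>m. m \<in> occ f \<Longrightarrow> weight w N m \<le> \<mu>"
  shows "weight_part w N \<mu> f \<in> ideal_gen (t_initial w N ` G)"
proof -
  let ?G = "ideal_gen (t_initial w N ` G)" and ?lead = "lead gt w N"
  have trivial: "weight_part w N \<mu> h \<in> ?G"
    if "\<And>m. m \<in> occ h \<Longrightarrow> weight w N m \<le> \<mu>" "h = 0 \<or> weight w N (?lead h) \<noteq> \<mu>" for h :: "('n, 'a) Rx"
  proof -
    have "weight w N m < \<mu>" if m: "m \<in> occ h" for m
    proof -
      have h: "h \<noteq> 0" using m occ_eq_empty_iff by blast
      then have "weight w N (?lead h) < \<mu>"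
        using \<open>h = 0 \<or> _\<close> \<open>\<And>m. m \<in> occ h \<Longrightarrow> _\<close> lead_in_occ[OF gt w h] by (metis order_le_less)
      then show ?thesis using weight_le_lead[OF gt w h m] by simp
    qed
    then show ?thesis by (simp add: weight_part_eq_0 ideal.span_zero)
  qed
  have "weight_part w N \<mu> h \<in> ?G"
    if "h \<in> I" "\<And>m. m \<in> occ h \<Longrightarrow> weight w N m \<le> \<mu>" "h \<noteq> 0" "weight w N (?lead h) = \<mu>" for h
    using that
  proof (induction "snd (?lead h)" arbitrary: h rule: wfp_induct_rule[OF wfp_global_monomial_ordering[OF gt]])
    case (1 h)
    note h = 1(2-5)
    obtain g d where g: "g \<in> G" "g \<noteq> 0" and d: "?lead h = d + ?lead g"
      using standard_basis_lead_divides[OF sb h(1,3)] by blast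
    define coeff where "coeff f m = fps_nth (Poly_Mapping.lookup f (snd m)) (fst m)" for f :: "('n, 'a) Rx" and m
    have occ: "m \<in> occ f \<longleftrightarrow> coeff f m \<noteq> 0" for f m by (cases m) (simp add: occ_def coeff_def)
    \<comment> \<open>the quotient of the leading coefficients, so that the leading terms cancel in \<open>h'\<close>\<close>
    define c where "c = coeff h (?lead h) / coeff g (?lead g)"
    define h' where "h' = h - term_mult d c g"
    have "coeff g (?lead g) \<noteq> 0" using lead_in_occ[OF gt w g(2)] by (simp add: occ)
    then have cancel: "coeff h' (?lead h) = 0"
      using coeff_term_mult[of d c g "snd (?lead g)" "fst (?lead g)"]
      by (simp add: h'_def coeff_def c_def d lookup_minus)
    have h'_I: "h' \<in> I"
    proof -
      have "g \<in> I" using g(1) sb by (auto simp: standard_basis_def)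
      then show ?thesis unfolding h'_def term_mult_def
        by (intro ideal.subspace_diff[OF I] ideal.subspace_scale[OF I] h(1))
    qed
    have below: "gt_w gt w N (?lead h) m" if m: "m \<in> occ h'" for m
    proof -
      have ne: "m \<noteq> ?lead h" using m cancel occ by auto
      consider "m \<in> occ h" | "m \<in> occ (term_mult d c g)"
        using m unfolding occ h'_def coeff_def lookup_minus fps_sub_nth by fastforce
      then show ?thesis
      proof cases
        case 1
        then show ?thesis using lead_greatest[OF gt w h(3)] ne by blast
      next
        case 2
        then obtain m' where m': "m' \<in> occ g" "m = d + m'" using occ_term_mult by blast
        then have "gt_w gt w N (?lead g) m'" using lead_greatest[OF gt w g(2)] ne d by auto
        then show ?thesis using gt_w_add[OF gt] m' d by metis
      qed
    qed
    have h'_le: "weight w N m \<le> \<mu>" if "m \<in> occ h'" for m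
      using below[OF that] h(4) by (auto simp: gt_w_def)
    have "weight_part w N \<mu> h' \<in> ?G"
    proof (cases "h' = 0 \<or> weight w N (?lead h') \<noteq> \<mu>")
      case False
      then have "gt (snd (?lead h)) (snd (?lead h'))"
        using below[OF lead_in_occ[OF gt w]] h(4) by (auto simp: gt_w_def)
      then show ?thesis using 1(1) h'_I h'_le False by blast
    qed (use trivial h'_le in blast)
    moreover have "weight_part w N \<mu> (term_mult d c g) = Poly_Mapping.single (snd d) c * t_initial w N g"
      using weight_part_term_mult[OF w, of d "weight w N (?lead g)" c g]
        t_initial_eq_weight_part_lead[OF gt w g(2)] h(4) d by (simp add: weight_add)
    moreover have "Poly_Mapping.single (snd d) c * t_initial w N g \<in> ?G"
      using g(1) by (intro ideal.span_scale ideal.span_base) auto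
    moreover have "weight_part w N \<mu> h = weight_part w N \<mu> h' + weight_part w N \<mu> (term_mult d c g)"
      by (simp add: h'_def weight_part_diff)
    ultimately show ?case by (metis ideal.span_add)
  qed
  then show ?thesis using trivial f le by blast
qed

lemma t_initial_ideal_standard_basis:
  fixes gt :: "'n::finite mon \<Rightarrow> 'n mon \<Rightarrow> bool" and I G :: "('n, 'a::field) Rx set"
  assumes gt: "global_monomial_ordering gt" and w: "fst w < 0" "N > 0"
    and I: "is_ideal I" and sb: "standard_basis gt w N I G"
  shows "t_initial_ideal w N I = ideal_gen (t_initial w N ` G)"
  unfolding t_initial_ideal_def
proof
  have "t_initial w N f \<in> ideal_gen (t_initial w N ` G)" if f: "f \<in> I" for f
  proof (cases "f = 0")
    case True
    then show ?thesis by (simp add: t_initial_0[OF w] ideal.span_zero)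
  next
    case False
    then show ?thesis
      by (subst t_initial_eq_weight_part[OF w])
        (rule weight_part_in_ideal[OF gt w I sb f max_weight(2)[OF w]])
  qed
  then show "ideal_gen (t_initial w N ` I) \<subseteq> ideal_gen (t_initial w N ` G)"
    by (intro ideal.span_minimal) auto
  show "ideal_gen (t_initial w N ` G) \<subseteq> ideal_gen (t_initial w N ` I)"
    using sb by (intro ideal.span_mono image_mono) (simp add: standard_basis_def)
qed

section \<open>The embedding of polynomial rings\<close>

lemma puiseux_nth_sum: "puiseux_nth (\<Sum>x\<in>A. f x) q = (\<Sum>x\<in>A. puiseux_nth (f x) q)"
  by (induction A rule: infinite_finite_induct) (simp_all add: zero_puiseux.rep_eq plus_puiseux.rep_eq)

lemma puiseux_t_pow_add: "puiseux_t_pow (a + b) = puiseux_t_pow a * puiseux_t_pow b"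
  by (rule puiseux_eqI) (auto simp: puiseux_nth_t_pow_mult puiseux_t_pow.rep_eq)

lemma puiseux_t_pow_0: "puiseux_t_pow 0 = 1"
  by (rule puiseux_eqI) (simp add: puiseux_t_pow.rep_eq one_puiseux.rep_eq)

lemma puiseux_of_fps_X_power:
  fixes F :: "'a::field fps"
  assumes N: "N > 0"
  shows "puiseux_of_fps N (fps_X ^ k * F) = puiseux_t_pow (of_nat k / of_nat N) * puiseux_of_fps N F"
proof (rule puiseux_eqI)
  fix q
  let ?q = "q - of_nat k / of_nat N :: rat"
  have "stretch N (fps_to_fls (fps_X ^ k * F)) q = stretch N (fps_to_fls F) ?q"
  proof (cases "\<exists>m. q = of_int m / of_nat N")
    case True
    then obtain m where m: "q = of_int m / of_nat N" ..
    then have q: "?q = of_int (m - int k) / of_nat N" by (simp add: diff_divide_distrib)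
    have "fls_nth (fps_to_fls (fps_X ^ k * F)) m = fls_nth (fps_to_fls F) (m - int k)"
      by (auto simp: fps_X_power_mult_nth nat_diff_distrib)
    then show ?thesis unfolding q unfolding m by (simp only: stretch_nth[OF N])
  next
    case False
    have "?q \<noteq> of_int m / of_nat N" for m
    proof
      assume "?q = of_int m / of_nat N"
      then have "q = of_int (m + int k) / of_nat N" by (simp add: add_divide_distrib algebra_simps)
      then show False using False by blast
    qed
    then show ?thesis using False stretch_eq_0 by metis
  qed
  then show "puiseux_nth (puiseux_of_fps N (fps_X ^ k * F)) q =
      puiseux_nth (puiseux_t_pow (of_nat k / of_nat N) * puiseux_of_fps N F) q"
    by (simp only: puiseux_nth_t_pow_mult puiseux_of_fps_def puiseux_of_fls.rep_eq)
qed

lemma puiseux_of_fps_0: "puiseux_of_fps N 0 = (0 :: 'a::field puiseux)"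
  and puiseux_of_fps_add: "puiseux_of_fps N (F + G) = puiseux_of_fps N F + puiseux_of_fps N G"
  and puiseux_of_fps_mult: "puiseux_of_fps N (F * G) = puiseux_of_fps N F * puiseux_of_fps N G"
  for F G :: "'a::field fps"
  by (simp_all add: puiseux_of_fps_def puiseux_of_fls_0 puiseux_of_fls_add puiseux_of_fls_mult
      fls_times_fps_to_fls)

lemma lookup_Lx_of_Rx: "Poly_Mapping.lookup (Lx_of_Rx N g) \<beta> = puiseux_of_fps N (Poly_Mapping.lookup g \<beta>)"
  by (simp add: Lx_of_Rx_def map.rep_eq when_def puiseux_of_fps_0)

lemma Lx_of_Rx_0: "Lx_of_Rx N 0 = 0"
  and Lx_of_Rx_add: "Lx_of_Rx N (f + g) = Lx_of_Rx N f + Lx_of_Rx N g"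
  by (rule poly_mapping_eqI, simp add: lookup_Lx_of_Rx lookup_add puiseux_of_fps_0 puiseux_of_fps_add)+

lemma Lx_of_Rx_sum: "Lx_of_Rx N (\<Sum>x\<in>A. f x) = (\<Sum>x\<in>A. Lx_of_Rx N (f x))"
  by (induction A rule: infinite_finite_induct) (simp_all add: Lx_of_Rx_0 Lx_of_Rx_add)

lemma Lx_of_Rx_single: "Lx_of_Rx N (Poly_Mapping.single \<beta> F) = Poly_Mapping.single \<beta> (puiseux_of_fps N F)"
  by (rule poly_mapping_eqI) (simp add: lookup_Lx_of_Rx lookup_single when_def puiseux_of_fps_0)

lemma Lx_of_Rx_mult: "Lx_of_Rx N (f * g) = Lx_of_Rx N f * Lx_of_Rx N g"
proof -
  have single: "Lx_of_Rx N (Poly_Mapping.single \<beta> F * g) = Lx_of_Rx N (Poly_Mapping.single \<beta> F) * Lx_of_Rx N g" for \<beta> F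
  proof (rule poly_mapping_eqI)
    fix \<gamma>
    show "Poly_Mapping.lookup (Lx_of_Rx N (Poly_Mapping.single \<beta> F * g)) \<gamma> =
      Poly_Mapping.lookup (Lx_of_Rx N (Poly_Mapping.single \<beta> F) * Lx_of_Rx N g) \<gamma>"
      by (cases "\<exists>\<delta>. \<gamma> = \<beta> + \<delta>")
        (auto simp: Lx_of_Rx_single lookup_Lx_of_Rx lookup_single_mult_add lookup_single_mult_eq_0
          puiseux_of_fps_0 puiseux_of_fps_mult)
  qed
  have "Lx_of_Rx N ((\<Sum>\<beta>\<in>A. Poly_Mapping.single \<beta> (F \<beta>)) * g) =
      Lx_of_Rx N (\<Sum>\<beta>\<in>A. Poly_Mapping.single \<beta> (F \<beta>)) * Lx_of_Rx N g" for A F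
    by (simp only: sum_distrib_right Lx_of_Rx_sum single)
  from this[of "Poly_Mapping.lookup f" "Poly_Mapping.keys f"] show ?thesis
    by (simp only: sum_single_lookup)
qed

lemma Lx_of_Rx_X_power:
  fixes g :: "('n, 'a::field) Rx"
  assumes "N > 0"
  shows "Lx_of_Rx N (Poly_Mapping.single 0 (fps_X ^ k) * g) =
    Poly_Mapping.single 0 (puiseux_t_pow (of_nat k / of_nat N)) * Lx_of_Rx N g"
proof -
  have "puiseux_of_fps N (fps_X ^ k :: 'a fps) = puiseux_t_pow (of_nat k / of_nat N)"
    using puiseux_of_fps_X_power[OF assms, of k "1 :: 'a fps"] assms
    by (simp add: puiseux_of_fps_def puiseux_of_fls_1)
  then show ?thesis by (simp add: Lx_of_Rx_mult Lx_of_Rx_single)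
qed

section \<open>Splitting by residue classes of exponents\<close>

abbreviation t_shift :: "rat \<Rightarrow> ('n, 'a::field) Lx \<Rightarrow> ('n, 'a) Lx" where
  "t_shift q f \<equiv> Poly_Mapping.single 0 (puiseux_t_pow q) * f"

lemma t_shift_t_shift: "t_shift a (t_shift b f) = t_shift (a + b) f"
  by (simp add: mult.assoc[symmetric] mult_single puiseux_t_pow_add)

text \<open>
  The exponents \<open>k/P\<close> are sorted by \<open>j = k mod P\<close>, that is, modulo \<open>1\<close>: if \<open>k = j + P l\<close> then
  \<open>k/P = j/P + l\<close>, and \<open>t\<^sup>l\<close> is a power of \<open>t\<^sup>1\<^sup>/\<^sup>N\<close> for every \<open>N\<close>, namely
  the one with exponent \<open>N l\<close>, whatever the relation between \<open>P\<close> and \<open>N\<close>.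
\<close>

lemma puiseux_of_fps_residue_split:
  fixes F :: "'a::field fps"
  assumes N: "N > 0" and P: "P > 0"
  defines "S \<equiv> \<lambda>j. Abs_fps (\<lambda>m. if N dvd m then fps_nth F (j + P * (m div N)) else 0)"
  shows "puiseux_of_fps P F =
    (\<Sum>j<P. puiseux_t_pow (of_nat j / of_nat P) * puiseux_of_fps N (S j))"
proof (rule puiseux_eqI)
  fix r :: rat
  let ?c = "\<lambda>j. puiseux_nth (puiseux_of_fps N (S j)) (r - of_nat j / of_nat P)"
  have supp: "\<exists>l. r = of_nat (j + P * l) / of_nat P \<and> ?c j = fps_nth F (j + P * l)" if j: "?c j \<noteq> 0" for j
  proof -
    obtain m where m: "r - of_nat j / of_nat P = of_nat m / of_nat N"
      using j by (rule puiseux_nth_of_fps_nonzeroE)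
    then have c: "?c j = fps_nth (S j) m" by (simp only: puiseux_nth_of_fps[OF N])
    then have "N dvd m" using j by (auto simp: S_def split: if_splits)
    then obtain l where l: "m = N * l" ..
    have "r = of_nat j / of_nat P + of_nat l" using m N unfolding l by simp
    then have "r = of_nat (j + P * l) / of_nat P" using P by (simp add: field_simps)
    moreover have "?c j = fps_nth F (j + P * l)" unfolding c l using N by (simp add: S_def)
    ultimately show ?thesis by blast
  qed
  have "puiseux_nth (puiseux_of_fps P F) r = (\<Sum>j<P. ?c j)"
  proof (cases "\<exists>k. r = of_nat k / of_nat P")
    case True
    then obtain k where "r = of_nat k / of_nat P" ..
    moreover obtain i l where il: "k = i + P * l" "i < P"
      using P by (metis mod_mult_div_eq mod_less_divisor)
    ultimately have r: "r = of_nat (i + P * l) / of_nat P" by simp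
    have "r - of_nat i / of_nat P = of_nat (N * l) / of_nat N"
      using N P unfolding r by (simp add: add_divide_distrib)
    then have ci: "?c i = fps_nth F (i + P * l)"
      using N by (simp only: puiseux_nth_of_fps) (simp add: S_def)
    have "?c j = 0" if j: "j < P" "j \<noteq> i" for j
    proof (rule ccontr)
      assume "?c j \<noteq> 0"
      then obtain l' where "r = of_nat (j + P * l') / of_nat P" using supp by blast
      then have "i + P * l = j + P * l'"
        using P unfolding r by (simp only: divide_cancel_right of_nat_eq_iff) simp
      then have "(i + P * l) mod P = (j + P * l') mod P" by (simp only:)
      then show False using j il(2) by simp
    qed
    then have "(\<Sum>j<P. ?c j) = (\<Sum>j<P. if j = i then ?c i else 0)"
      by (intro sum.cong) auto
    also have "\<dots> = fps_nth F (i + P * l)" using il(2) ci by simp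
    finally show ?thesis unfolding r by (simp only: puiseux_nth_of_fps[OF P])
  next
    case False
    then have "?c j = 0" for j using supp by metis
    moreover have "puiseux_nth (puiseux_of_fps P F) r = 0"
      using False puiseux_nth_of_fps_nonzeroE by metis
    ultimately show ?thesis by simp
  qed
  then show "puiseux_nth (puiseux_of_fps P F) r =
    puiseux_nth (\<Sum>j<P. puiseux_t_pow (of_nat j / of_nat P) * puiseux_of_fps N (S j)) r"
    by (simp only: puiseux_nth_sum puiseux_nth_t_pow_mult)
qed

text \<open>
  The powers of \<open>t\<close> generate \<open>L[x]\<close> as a module over \<open>R\<^sub>N[x]\<close>.  Consequently every element of the
  ideal that \<open>I\<close> generates in \<open>L[x]\<close> is a sum of elements of \<open>I\<close> times powers of \<open>t\<close>.
\<close>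

lemma Lx_residue_split:
  fixes c :: "('n, 'a::field) Lx"
  assumes N: "N > 0"
  obtains P :: nat and q C where "c = (\<Sum>j<P. t_shift (q j) (Lx_of_Rx N (C j)))"
proof -
  obtain P \<alpha> g where P: "P > 0" and c: "c = t_shift (- (of_nat \<alpha> / of_nat P)) (Lx_of_Rx P g)"
    by (rule Lx_representation)
  define S where "S j F = Abs_fps (\<lambda>m. if N dvd m then fps_nth F (j + P * (m div N)) else 0)" for j and F :: "'a fps"
  define C where "C j = Poly_Mapping.map (S j) g" for j
  have C: "Poly_Mapping.lookup (C j) \<beta> = S j (Poly_Mapping.lookup g \<beta>)" for j \<beta>
    by (auto simp: C_def map.rep_eq when_def S_def fps_eq_iff)
  have "Lx_of_Rx P g = (\<Sum>j<P. t_shift (of_nat j / of_nat P) (Lx_of_Rx N (C j)))"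
  proof (rule poly_mapping_eqI)
    fix \<beta>
    show "Poly_Mapping.lookup (Lx_of_Rx P g) \<beta> =
        Poly_Mapping.lookup (\<Sum>j<P. t_shift (of_nat j / of_nat P) (Lx_of_Rx N (C j))) \<beta>"
      unfolding lookup_sum lookup_shifted lookup_Lx_of_Rx C S_def
      by (rule puiseux_of_fps_residue_split[OF N P])
  qed
  then have "c = (\<Sum>j<P. t_shift (- (of_nat \<alpha> / of_nat P) + of_nat j / of_nat P) (Lx_of_Rx N (C j)))"
    by (simp only: c sum_distrib_left t_shift_t_shift)
  then show thesis by (rule that)
qed

definition incongruent :: "nat \<Rightarrow> rat set \<Rightarrow> bool" where
  "incongruent N A \<longleftrightarrow> (\<forall>q\<in>A. \<forall>q'\<in>A. \<forall>k::int. q - q' = of_int k / of_nat N \<longrightarrow> q = q')"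

text \<open>
  Incongruent exponents make the summands \<open>t\<^sup>q g\<^sub>q\<close> have no monomial in common.
\<close>

definition separated_sum :: "nat \<Rightarrow> ('n, 'a::field) Rx set \<Rightarrow> ('n, 'a) Lx \<Rightarrow> bool" where
  "separated_sum N I f \<longleftrightarrow> (\<exists>A g. finite A \<and> incongruent N A \<and> (\<forall>q\<in>A. g q \<in> I) \<and>
     f = (\<Sum>q\<in>A. t_shift q (Lx_of_Rx N (g q))))"

text \<open>
  If the new exponent \<open>q\<close> is congruent to some \<open>a\<close> that is already present, the two summands are merged at
  the smaller of the two exponents: the other one differs by \<open>k/N\<close> with \<open>k\<close> a natural number, and the factor
  \<open>t\<^sup>k\<^sup>/\<^sup>N\<close> lies in \<open>R\<^sub>N\<close> and is absorbed into the element of \<open>I\<close>.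
\<close>

lemma separated_sum_add:
  fixes I :: "('n, 'a::field) Rx set"
  assumes N: "N > 0" and I: "is_ideal I" and h: "h \<in> I" and f: "separated_sum N I f"
  shows "separated_sum N I (t_shift q (Lx_of_Rx N h) + f)"
proof -
  from f obtain A g where A: "finite A" "\<And>q. q \<in> A \<Longrightarrow> g q \<in> I"
    and inc: "incongruent N A"
    and f: "f = (\<Sum>q\<in>A. t_shift q (Lx_of_Rx N (g q)))"
    unfolding separated_sum_def by blast
  have sep: "q = q'" if "q \<in> A" "q' \<in> A" "q - q' = of_int k / of_nat N" for q q' and k :: int
    using inc that unfolding incongruent_def by blast
  \<comment> \<open>\<open>a\<close> is dropped in favour of \<open>p\<close>; for \<open>a \<notin> A\<close> this is plain insertion, and \<open>p = a\<close> replaces a summand\<close>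
  have replace: "separated_sum N I (t_shift p (Lx_of_Rx N u) + (\<Sum>q\<in>A - {a}. t_shift q (Lx_of_Rx N (g q))))"
    if u: "u \<in> I" and p: "\<And>b k. b \<in> A - {a} \<Longrightarrow> p - b \<noteq> of_int k / of_nat N" for p a u
    unfolding separated_sum_def
  proof (intro exI[of _ "insert p (A - {a})"] exI[of _ "g(p := u)"] conjI ballI)
    have neg: "p - b = of_int (- k) / of_nat N" if "b - p = of_int k / of_nat N" for b k
      using that by (simp add: minus_divide_left[symmetric])
    have pA: "p \<notin> A - {a}" using p[of p 0] by auto
    show "incongruent N (insert p (A - {a}))"
      unfolding incongruent_def
    proof (intro ballI allI impI)
      fix x y k assume xy: "x \<in> insert p (A - {a})" "y \<in> insert p (A - {a})" and k: "x - y = of_int k / of_nat N"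
      from xy consider "x = y" | "x = p" "y \<in> A - {a}" | "y = p" "x \<in> A - {a}" | "x \<in> A" "y \<in> A"
        by blast
      then show "x = y"
      proof cases
        case 2
        then show ?thesis using p[of y k] k by simp
      next
        case 3
        then show ?thesis using p neg k by blast
      next
        case 4
        then show ?thesis using sep k by blast
      qed
    qed
    show "t_shift p (Lx_of_Rx N u) + (\<Sum>q\<in>A - {a}. t_shift q (Lx_of_Rx N (g q))) =
        (\<Sum>q\<in>insert p (A - {a}). t_shift q (Lx_of_Rx N ((g(p := u)) q)))"
      using A(1) pA by (simp add: sum.insert) (intro sum.cong; auto)
  qed (use A u in auto)
  have merge: "t_shift a (Lx_of_Rx N u) + t_shift (a + of_nat k / of_nat N) (Lx_of_Rx N v) =
      t_shift a (Lx_of_Rx N (u + Poly_Mapping.single 0 (fps_X ^ k) * v))" for a k and u v :: "('n, 'a) Rx"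
    by (simp only: Lx_of_Rx_add Lx_of_Rx_X_power[OF N] distrib_left t_shift_t_shift)
  have I_merge: "u + Poly_Mapping.single 0 (fps_X ^ k) * v \<in> I" if "u \<in> I" "v \<in> I" for u v k
    by (intro ideal.subspace_add[OF I] ideal.subspace_scale[OF I] that)
  show ?thesis
  proof (cases "\<exists>a\<in>A. \<exists>k::int. q - a = of_int k / of_nat N")
    case False
    have "separated_sum N I (t_shift q (Lx_of_Rx N h) + (\<Sum>q\<in>A - {q}. t_shift q (Lx_of_Rx N (g q))))"
      by (rule replace[OF h]) (use False in blast)
    moreover have "q \<notin> A"
    proof
      assume "q \<in> A"
      moreover have "q - q = of_int 0 / of_nat N" by simp
      ultimately show False using False by blast
    qed
    ultimately show ?thesis by (simp add: f)
  next
    case True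
    then obtain a k where a: "a \<in> A" and k: "q - a = of_int k / of_nat N" by blast
    have other: "p - b \<noteq> of_int l / of_nat N"
      if "b \<in> A - {a}" "p - a = of_int m / of_nat N" for p b l m
    proof
      assume "p - b = of_int l / of_nat N"
      then have "a - b = of_int (l - m) / of_nat N"
        using that(2) by (simp add: diff_divide_distrib algebra_simps)
      then show False using sep a that(1) by blast
    qed
    have f': "f = t_shift a (Lx_of_Rx N (g a)) + (\<Sum>q\<in>A - {a}. t_shift q (Lx_of_Rx N (g q)))"
      unfolding f using A(1) a by (rule sum.remove)
    show ?thesis
    proof (cases "k \<ge> 0")
      case True
      then have q: "q = a + of_nat (nat k) / of_nat N" using k by (simp add: algebra_simps)
      have "t_shift q (Lx_of_Rx N h) + f =
          t_shift a (Lx_of_Rx N (g a + Poly_Mapping.single 0 (fps_X ^ nat k) * h)) +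
          (\<Sum>q\<in>A - {a}. t_shift q (Lx_of_Rx N (g q)))"
        unfolding f' q merge[symmetric] by (simp only: add_ac)
      moreover have "separated_sum N I \<dots>"
        by (rule replace[OF I_merge[OF A(2)[OF a] h] other[of _ a 0]]) auto
      ultimately show ?thesis by (simp only:)
    next
      case False
      then have "of_nat (nat (- k)) = (- of_int k :: rat)" by simp
      then have a': "a = q + of_nat (nat (- k)) / of_nat N" using k by (simp add: algebra_simps)
      have "t_shift q (Lx_of_Rx N h) + f =
          t_shift q (Lx_of_Rx N (h + Poly_Mapping.single 0 (fps_X ^ nat (- k)) * g a)) +
          (\<Sum>q\<in>A - {a}. t_shift q (Lx_of_Rx N (g q)))"
        unfolding f' merge[symmetric] a'[symmetric] by (simp only: add_ac)
      moreover have "separated_sum N I \<dots>"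
        by (rule replace[OF I_merge[OF h A(2)[OF a]] other[OF _ k]])
      ultimately show ?thesis by (simp only:)
    qed
  qed
qed

lemma extended_ideal_separated_sum:
  fixes I :: "('n, 'a::field) Rx set"
  assumes N: "N > 0" and I: "is_ideal I" and f: "f \<in> ideal_gen (Lx_of_Rx N ` I)"
  shows "separated_sum N I f"
  using f
proof (induction rule: ideal.span_induct_alt)
  case base
  show ?case unfolding separated_sum_def by (rule exI[of _ "{}"]) (simp add: incongruent_def)
next
  case (step c x y)
  then obtain h where h: "h \<in> I" "x = Lx_of_Rx N h" by blast
  obtain P :: nat and q C where c: "c = (\<Sum>j<P. t_shift (q j) (Lx_of_Rx N (C j)))"
    using Lx_residue_split[OF N] by blast
  have "separated_sum N I ((\<Sum>j<n. t_shift (q j) (Lx_of_Rx N (C j * h))) + y)" for n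
  proof (induction n)
    case (Suc n)
    then show ?case
      using separated_sum_add[OF N I ideal.subspace_scale[OF I h(1), of "C n"] Suc, of "q n"]
      by (simp add: add_ac)
  qed (use step in simp)
  moreover have "c * x = (\<Sum>j<P. t_shift (q j) (Lx_of_Rx N (C j * h)))"
    unfolding c h(2) sum_distrib_right Lx_of_Rx_mult by (simp only: mult.assoc)
  ultimately show ?case by (simp only:)
qed

section \<open>Initial forms over the Puiseux field\<close>

definition weight_L :: "real \<times> (real ^ 'n) \<Rightarrow> rat \<Rightarrow> 'n::finite mon \<Rightarrow> real" where
  "weight_L w q \<beta> = fst w * of_rat q + snd w \<bullet> (\<chi> i. real (Poly_Mapping.lookup \<beta> i))"

lemma weight_L_shift: "weight_L w (of_nat \<alpha> / of_nat N + q) \<beta> = weight w N (\<alpha>, \<beta>) + fst w * of_rat q"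
  by (simp add: weight_L_def weight_eq of_rat_add of_rat_divide distrib_left)

definition weight_part_L :: "real \<times> (real ^ 'n) \<Rightarrow> real \<Rightarrow> ('n::finite, 'a::field) Lx \<Rightarrow> ('n, 'a) Kx" where
  "weight_part_L w \<mu> f = Poly_Mapping.mapp (\<lambda>\<beta> c. \<Sum>q | weight_L w q \<beta> = \<mu>. puiseux_nth c q) f"

lemma lookup_weight_part_L:
  "Poly_Mapping.lookup (weight_part_L w \<mu> f) \<beta> =
     (\<Sum>q | weight_L w q \<beta> = \<mu>. puiseux_nth (Poly_Mapping.lookup f \<beta>) q)"
  by (simp add: weight_part_L_def lookup_mapp when_def in_keys_iff zero_puiseux.rep_eq)

lemma weight_part_L_sum: "weight_part_L w \<mu> (\<Sum>x\<in>A. f x) = (\<Sum>x\<in>A. weight_part_L w \<mu> (f x))"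
proof (induction A rule: infinite_finite_induct)
  case (insert x A)
  have "weight_part_L w \<mu> (f + g) = weight_part_L w \<mu> f + weight_part_L w \<mu> g" for f g :: "('a, 'b) Lx"
    by (rule poly_mapping_eqI)
      (simp add: lookup_weight_part_L lookup_add plus_puiseux.rep_eq sum.distrib)
  with insert show ?case by simp
qed (simp_all add: weight_part_L_def poly_mapping_eq_iff lookup_mapp fun_eq_iff)

lemma weight_part_L_t_shift:
  assumes w: "fst w < 0" "N > 0"
  shows "weight_part_L w \<mu> (t_shift q (Lx_of_Rx N g)) = weight_part w N (\<mu> - fst w * of_rat q) g"
proof (rule poly_mapping_eqI)
  fix \<beta>
  let ?c = "\<lambda>r. puiseux_nth (puiseux_of_fps N (Poly_Mapping.lookup g \<beta>)) (r - q)"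
  have L: "Poly_Mapping.lookup (weight_part_L w \<mu> (t_shift q (Lx_of_Rx N g))) \<beta> =
      (\<Sum>r | weight_L w r \<beta> = \<mu>. ?c r)"
    by (simp only: lookup_weight_part_L lookup_shifted puiseux_nth_t_pow_mult)
  show "Poly_Mapping.lookup (weight_part_L w \<mu> (t_shift q (Lx_of_Rx N g))) \<beta> =
      Poly_Mapping.lookup (weight_part w N (\<mu> - fst w * of_rat q) g) \<beta>"
  proof (cases "\<exists>\<alpha>. weight w N (\<alpha>, \<beta>) = \<mu> - fst w * of_rat q")
    case True
    then obtain \<alpha> where \<alpha>: "weight w N (\<alpha>, \<beta>) = \<mu> - fst w * of_rat q" ..
    then have "weight_L w (of_nat \<alpha> / of_nat N + q) \<beta> = \<mu>" by (simp add: weight_L_shift)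
    moreover have "r = r'" if "weight_L w r \<beta> = weight_L w r' \<beta>" for r r'
      using that w by (simp add: weight_L_def of_rat_eq_iff)
    ultimately have "{r. weight_L w r \<beta> = \<mu>} = {of_nat \<alpha> / of_nat N + q}" by blast
    then show ?thesis
      unfolding L lookup_weight_part_at[OF w \<alpha>] by (simp add: puiseux_nth_of_fps[OF w(2)])
  next
    case False
    have "?c r = 0" if "weight_L w r \<beta> = \<mu>" for r
    proof (rule ccontr)
      assume "?c r \<noteq> 0"
      then obtain \<alpha> where "r - q = of_nat \<alpha> / of_nat N" by (rule puiseux_nth_of_fps_nonzeroE)
      then have "r = of_nat \<alpha> / of_nat N + q" by simp
      then show False using that False weight_L_shift[of w \<alpha> N q \<beta>] by auto
    qed
    then have "(\<Sum>r | weight_L w r \<beta> = \<mu>. ?c r) = 0" by (intro sum.neutral) blast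
    moreover have "Poly_Mapping.lookup (weight_part w N (\<mu> - fst w * of_rat q) g) \<beta> = 0"
      using False by (intro lookup_weight_part_eq_0) blast
    ultimately show ?thesis unfolding L by simp
  qed
qed

text \<open>
  Here \<open>\<mu>\<close> is the maximal weight of \<open>f\<close> itself: that of a representative over some \<open>R\<^sub>N\<close>,
  corrected by the weight of the power of \<open>t\<close> that was split off.
\<close>

lemma t_initial_L_eq_weight_part_L:
  assumes w: "fst w < 0" and f: "f \<noteq> 0"
  obtains \<mu> where "t_initial_L w f = weight_part_L w \<mu> f"
    and "\<And>\<beta> r. puiseux_nth (Poly_Mapping.lookup f \<beta>) r \<noteq> 0 \<Longrightarrow> weight_L w r \<beta> \<le> \<mu>"
proof -
  obtain N \<alpha> g where N: "N > 0" and fg: "f = t_shift (- (of_nat \<alpha> / of_nat N)) (Lx_of_Rx N g)"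
    by (rule Lx_representation)
  let ?q = "- (of_nat \<alpha> / of_nat N) :: rat"
  have g: "g \<noteq> 0" using f by (auto simp: fg Lx_of_Rx_0)
  define \<mu> where "\<mu> = max_weight w N g + fst w * of_rat ?q"
  show thesis
  proof (rule that[of \<mu>])
    show "t_initial_L w f = weight_part_L w \<mu> f"
      unfolding t_initial_L_eq[OF w N fg] t_initial_eq_weight_part[OF w N]
      unfolding fg weight_part_L_t_shift[OF w N] \<mu>_def by simp
    fix \<beta> r assume "puiseux_nth (Poly_Mapping.lookup f \<beta>) r \<noteq> 0"
    then have c: "puiseux_nth (puiseux_of_fps N (Poly_Mapping.lookup g \<beta>)) (r - ?q) \<noteq> 0"
      by (simp only: fg lookup_shifted puiseux_nth_t_pow_mult) simp
    then obtain k where k: "r - ?q = of_nat k / of_nat N" by (rule puiseux_nth_of_fps_nonzeroE)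
    have "(k, \<beta>) \<in> occ g" using c unfolding k puiseux_nth_of_fps[OF N] by (simp add: occ_def)
    then have "weight w N (k, \<beta>) \<le> max_weight w N g" by (rule max_weight(2)[OF w N g])
    moreover have "r = of_nat k / of_nat N + ?q" using k by (simp add: algebra_simps)
    ultimately show "weight_L w r \<beta> \<le> \<mu>" using weight_L_shift[of w k N ?q \<beta>] by (simp add: \<mu>_def)
  qed
qed

lemma t_initial_L_of_Rx:
  assumes "fst w < 0" "N > 0"
  shows "t_initial_L w (Lx_of_Rx N g) = t_initial w N g"
  by (rule t_initial_L_eq[OF assms, of _ 0]) (simp add: puiseux_t_pow_0)

text \<open>
  Since no two summands \<open>t\<^sup>q g\<^sub>q\<close> share a monomial, every monomial of a summand occurs in \<open>f\<close>.  The
  weights of \<open>t\<^sup>q g\<^sub>q\<close> are therefore at most the maximal weight \<open>\<mu>\<close> of \<open>f\<close>, and its part of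
  weight \<open>\<mu>\<close> is zero or the \<open>t\<close>-initial form of \<open>g\<^sub>q\<close>.
\<close>

lemma t_initial_L_in_ideal:
  fixes I :: "('n::finite, 'a::field) Rx set"
  assumes w: "fst w < 0" "N > 0" and I: "is_ideal I" and f: "f \<in> ideal_gen (Lx_of_Rx N ` I)"
  shows "t_initial_L w f \<in> t_initial_ideal w N I"
proof (cases "f = 0")
  case True
  then have "t_initial_L w f = 0"
    using t_initial_L_of_Rx[OF w, of 0] by (simp add: Lx_of_Rx_0 t_initial_0[OF w])
  then show ?thesis by (simp add: t_initial_ideal_def ideal.span_zero)
next
  case False
  obtain \<mu> where \<mu>: "t_initial_L w f = weight_part_L w \<mu> f"
    "\<And>\<beta> r. puiseux_nth (Poly_Mapping.lookup f \<beta>) r \<noteq> 0 \<Longrightarrow> weight_L w r \<beta> \<le> \<mu>"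
    using t_initial_L_eq_weight_part_L[OF w(1) False] by blast
  have "separated_sum N I f" by (rule extended_ideal_separated_sum[OF w(2) I f])
  then obtain A g where A: "finite A" "\<And>q. q \<in> A \<Longrightarrow> g q \<in> I"
    and inc: "incongruent N A"
    and fA: "f = (\<Sum>q\<in>A. t_shift q (Lx_of_Rx N (g q)))"
    unfolding separated_sum_def by blast
  have sep: "q = q'" if "q \<in> A" "q' \<in> A" "q - q' = of_int k / of_nat N" for q q' and k :: int
    using inc that unfolding incongruent_def by blast
  have nth_f: "puiseux_nth (Poly_Mapping.lookup f \<beta>) r =
      (\<Sum>q\<in>A. puiseux_nth (puiseux_of_fps N (Poly_Mapping.lookup (g q) \<beta>)) (r - q))" for \<beta> r
    by (simp only: fA lookup_sum lookup_shifted puiseux_nth_sum puiseux_nth_t_pow_mult)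
  have bound: "weight w N m \<le> \<mu> - fst w * of_rat q" if q: "q \<in> A" and m: "m \<in> occ (g q)" for q m
  proof -
    obtain \<alpha> \<beta> where m': "m = (\<alpha>, \<beta>)" by (cases m)
    let ?r = "of_nat \<alpha> / of_nat N + q :: rat"
    have "puiseux_nth (puiseux_of_fps N (Poly_Mapping.lookup (g q') \<beta>)) (?r - q') = 0"
      if q': "q' \<in> A" "q' \<noteq> q" for q'
    proof (rule ccontr)
      assume "\<not> ?thesis"
      then obtain k where "?r - q' = of_nat k / of_nat N" by (rule puiseux_nth_of_fps_nonzeroE)
      then have "q - q' = of_int (int k - int \<alpha>) / of_nat N"
        by (simp add: diff_divide_distrib algebra_simps)
      then show False using sep q q' by blast
    qed
    then have "puiseux_nth (Poly_Mapping.lookup f \<beta>) ?r =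
        (\<Sum>q'\<in>A. if q' = q then puiseux_nth (puiseux_of_fps N (Poly_Mapping.lookup (g q) \<beta>)) (?r - q) else 0)"
      unfolding nth_f by (intro sum.cong) auto
    also have "\<dots> = fps_nth (Poly_Mapping.lookup (g q) \<beta>) \<alpha>"
      using A(1) q by (simp add: puiseux_nth_of_fps[OF w(2)])
    also have "\<dots> \<noteq> 0" using m by (simp add: m' occ_def)
    finally have "weight_L w ?r \<beta> \<le> \<mu>" by (rule \<mu>(2))
    then show ?thesis unfolding m' weight_L_shift by simp
  qed
  have "weight_part w N (\<mu> - fst w * of_rat q) (g q) \<in> t_initial_ideal w N I" if q: "q \<in> A" for q
    using weight_part_upper_bound[OF w bound[OF q]] A(2)[OF q]
    unfolding t_initial_ideal_def by (metis ideal.span_zero ideal.span_base imageI)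
  then have "(\<Sum>q\<in>A. weight_part w N (\<mu> - fst w * of_rat q) (g q)) \<in> t_initial_ideal w N I"
    unfolding t_initial_ideal_def by (rule ideal.span_sum)
  then show ?thesis unfolding \<mu>(1) by (simp only: fA weight_part_L_sum weight_part_L_t_shift[OF w])
qed

lemma t_initial_ideal_extended:
  fixes I :: "('n::finite, 'a::field) Rx set"
  assumes w: "fst w < 0" "N > 0" and I: "is_ideal I"
  shows "t_initial_ideal_L w (ideal_gen (Lx_of_Rx N ` I)) = t_initial_ideal w N I"
proof
  show "t_initial_ideal_L w (ideal_gen (Lx_of_Rx N ` I)) \<subseteq> t_initial_ideal w N I"
    unfolding t_initial_ideal_L_def
  proof (rule ideal.span_minimal)
    show "is_ideal (t_initial_ideal w N I)" by (simp add: t_initial_ideal_def)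
  qed (use t_initial_L_in_ideal[OF w I] in blast)
  have "t_initial w N ` I \<subseteq> t_initial_L w ` ideal_gen (Lx_of_Rx N ` I)"
    using t_initial_L_of_Rx[OF w] ideal.span_base by (metis (no_types, lifting) image_eqI image_subsetI)
  then show "t_initial_ideal w N I \<subseteq> t_initial_ideal_L w (ideal_gen (Lx_of_Rx N ` I))"
    unfolding t_initial_ideal_def t_initial_ideal_L_def by (rule ideal.span_mono)
qed

theorem theorem6p10:
  fixes gt :: "'n::finite mon \<Rightarrow> 'n mon \<Rightarrow> bool"
    and w :: "real \<times> (real ^ 'n)"
    and N :: nat
    and I G :: "('n, 'a::field) Rx set"
    and J :: "('n, 'a) Lx set"
  assumes "global_monomial_ordering gt"
    and "fst w < 0"
    and "N \<ge> 1"
    and "is_ideal J" and "is_ideal I"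
    and "J = ideal_gen (Lx_of_Rx N ` I)"
    and "standard_basis gt w N I G"
  shows "t_initial_ideal_L w J = t_initial_ideal w N I \<and>
    t_initial_ideal w N I = ideal_gen (t_initial w N ` G)"
proof
  have N: "N > 0" using assms(3) by simp
  show "t_initial_ideal_L w J = t_initial_ideal w N I"
    unfolding assms(6) by (rule t_initial_ideal_extended[OF assms(2) N assms(5)])
  show "t_initial_ideal w N I = ideal_gen (t_initial w N ` G)"
    by (rule t_initial_ideal_standard_basis[OF assms(1,2) N assms(5,7)])
qed

end
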